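(* The modal logic $\mathsf{S5}$ has the local coequivalence separation property (LCoSP), and so does its infinitary extension $\mathsf{S5}^\infty$.
   Context: **Formulas and consequence.** For $\mathsf{S5}$: formulas of basic modal logic; $\overline p,\overline q,\overline r$ denote finite tuples of distinct variables (different tuples disjoint), and $\overline p_1,\overline p_2,\dots$ are disjoint copies of $\overline p$ (with $p_i$ the copy of $p\in\overline p$ in $\overline p_i$). $\phi(\overline p)$ means the variables of $\phi$ are among $\overline p$. The relation $\alpha\vdash\beta$ is global consequence: $\beta$ is derivable from $\alpha$ and the theorems of $\mathsf{S5}$ using Modus Ponens and Necessitation (uniform substitution only applied to axioms); equivalently, in every Kripke model based on a finite cluster (a finite nonempty set with the total relation), if $\alpha$ is true at all points then $\beta$ is true at all points. For $\mathsf{S5}^\infty$ (the infinitary extension of $\mathsf{S5}$ whose algebraic models are the profinite $\mathsf{S5}$-algebras, dually the locally finite $\mathsf{S5}$-frames, i.e. sets with an equivalence relation all of whose classes are finite): formulas are built from variables using $\neg$, $\Box$ and conjunctions of arbitrary sets of formulas; $\overline p,\overline q,\overline r$ are arbitrary sets (tuples) of variables; and $\alpha\vdash\beta$ means that in every Kripke model based on a locally finite $\mathsf{S5}$-frame, if $\alpha$ is true at all points then $\beta$ is true at all points. **LCoSP**, for $L=\mathsf{S5}$ or $L=\mathsf{S5}^\infty$, writing $\vdash_L$ for the corresponding consequence. For $\alpha(\overline p)$ let $\mathsf{Ext}(\alpha)=\{\beta(\overline p,\overline q):\beta\vdash_L\alpha\}$. Let $\beta(\overline p,\overline q)\in\mathsf{Ext}(\alpha)$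 and $\gamma(\overline p,\overline q,\overline r)\in\mathsf{Ext}(\beta)$. A sequence $\overline\xi=(\xi_r(\overline p,\overline q_1,\overline q_2,\overline r))_{r\in\overline r}$ of formulas is a sequence of *local transition terms* for $\gamma$ if: - ($\gamma$-compatibility) $\gamma(\overline p,\overline q_1,\overline r)\wedge\beta(\overline p,\overline q_2)\vdash_L\gamma(\overline p,\overline q_2,\overline\xi)$; - (Identity) for each $r\in\overline r$, $\gamma(\overline p,\overline q,\overline r)\vdash_L r\leftrightarrow\xi_r(\overline p,\overline q,\overline q,\overline r)$; - (Cocycle) for each $r\in\overline r$, $\gamma(\overline p,\overline q_1,\overline r)\wedge\beta(\overline p,\overline q_2)\wedge\beta(\overline p,\overline q_3)\vdash_L\xi_r(\overline p,\overline q_1,\overline q_3,\overline r)\leftrightarrow\xi_r(\overline p,\overline q_2,\overline q_3,\overline\xi(\overline p,\overline q_1,\overline q_2,\overline r))$. The associated *local coequivalence relation* is $$\rho_{\gamma,\overline\xi}=\gamma(\overline p_1,\overline q_1,\overline r_1)\wedge\gamma(\overline p_2,\overline q_2,\overline r_2)\wedge\bigwedge_{p\in\overline p}(p_1\leftrightarrow p_2)\wedge\bigwedge_{r\in\overline r}(\xi_r(\overline p_1,\overline q_1,\overline q_2,\overline r_1)\leftrightarrow r_2).$$ It *separates variables* if there is a family of formulas $(\psi_i)_{i\in I}$ in the variables $\overline p,\overline q,\overline r$ ($I$ finite for $\mathsf{S5}$, $I$ any set for $\mathsf{S5}^\infty$) such that $\rho_{\gamma,\overline\xi}$ is $\vdash_L$-interderivable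 with $$\gamma(\overline p_1,\overline q_1,\overline r_1)\wedge\gamma(\overline p_2,\overline q_2,\overline r_2)\wedge\bigwedge_{i\in I}\big(\psi_i(\overline p_1,\overline q_1,\overline r_1)\leftrightarrow\psi_i(\overline p_2,\overline q_2,\overline r_2)\big).$$ $L$ has the *LCoSP* if for all $\alpha$, $\beta\in\mathsf{Ext}(\alpha)$, $\gamma\in\mathsf{Ext}(\beta)$ and all local transition terms $\overline\xi$ for $\gamma$, the relation $\rho_{\gamma,\overline\xi}$ separates variables. *)

theory Defs
  imports Main
begin

section \<open>Tuples of variables and their copies\<close>

text \<open>
  The members of the tuples p, q, r are named by elements of a type \<open>'x\<close>.  The number is the
  copy: 0 stands for the unindexed tuple, \<open>i\<close> for its \<open>i\<close>-th copy.  So distinct tuples and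
  distinct copies are automatically disjoint.  A tuple is given by its set of names.
\<close>

datatype 'x pqr_var = PVar nat 'x | QVar nat 'x | RVar nat 'x


section \<open>Logics, and the local coequivalence separation property\<close>

text \<open>
  The data of a logic that the property refers to.  \<open>tuple\<close> says which sets of names may be used
  as tuples of variables, and \<open>family\<close> of which sets of formulas \<open>bigcnj\<close> forms the conjunction.
  \<open>subst\<close> is simultaneous substitution of formulas for variables.
\<close>

record ('x, 'f) modal_logic =
  atom    :: "'x pqr_var \<Rightarrow> 'f"
  neg     :: "'f \<Rightarrow> 'f"
  cnj     :: "'f \<Rightarrow> 'f \<Rightarrow> 'f"
  bigcnj  :: "'f set \<Rightarrow> 'f"
  vars    :: "'f \<Rightarrow> 'x pqr_var set"
  subst   :: "('x pqr_var \<Rightarrow> 'f) \<Rightarrow> 'f \<Rightarrow> 'f"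
  entails :: "'f \<Rightarrow> 'f \<Rightarrow> bool"
  tuple   :: "'x set \<Rightarrow> bool"
  family  :: "'f set \<Rightarrow> bool"

definition bicond :: "('x, 'f, 'm) modal_logic_scheme \<Rightarrow> 'f \<Rightarrow> 'f \<Rightarrow> 'f" where
  "bicond L a b = cnj L (neg L (cnj L a (neg L b))) (neg L (cnj L b (neg L a)))"

definition pv :: "('x, 'f, 'm) modal_logic_scheme \<Rightarrow> nat \<Rightarrow> 'x \<Rightarrow> 'f" where
  "pv L i x = atom L (PVar i x)"

definition qv :: "('x, 'f, 'm) modal_logic_scheme \<Rightarrow> nat \<Rightarrow> 'x \<Rightarrow> 'f" where
  "qv L i x = atom L (QVar i x)"

definition rv :: "('x, 'f, 'm) modal_logic_scheme \<Rightarrow> nat \<Rightarrow> 'x \<Rightarrow> 'f" where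
  "rv L i x = atom L (RVar i x)"

text \<open>
  For a formula \<open>c\<close> in the unindexed variables, \<open>inst3 L c p q r\<close> is \<open>c(p,q,r)\<close>: the tuples of
  formulas \<open>p\<close>, \<open>q\<close>, \<open>r\<close> replace the tuples of variables.  \<open>inst2 L b p q\<close> is the same for
  formulas without r-variables.
  For a formula \<open>t\<close> written in the variables p, the first and second copy of q, and r,
  \<open>inst4 L t p q q' r\<close> is \<open>t(p,q,q',r)\<close>.
\<close>

definition inst3 ::
  "('x, 'f, 'm) modal_logic_scheme \<Rightarrow> 'f \<Rightarrow> ('x \<Rightarrow> 'f) \<Rightarrow> ('x \<Rightarrow> 'f) \<Rightarrow> ('x \<Rightarrow> 'f) \<Rightarrow> 'f" where
  "inst3 L c p q r =
     subst L (\<lambda>v. case v of PVar _ x \<Rightarrow> p x | QVar _ x \<Rightarrow> q x | RVar _ x \<Rightarrow> r x) c"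

definition inst2 ::
  "('x, 'f, 'm) modal_logic_scheme \<Rightarrow> 'f \<Rightarrow> ('x \<Rightarrow> 'f) \<Rightarrow> ('x \<Rightarrow> 'f) \<Rightarrow> 'f" where
  "inst2 L b p q = inst3 L b p q (rv L 0)"

definition inst4 ::
  "('x, 'f, 'm) modal_logic_scheme \<Rightarrow> 'f \<Rightarrow>
    ('x \<Rightarrow> 'f) \<Rightarrow> ('x \<Rightarrow> 'f) \<Rightarrow> ('x \<Rightarrow> 'f) \<Rightarrow> ('x \<Rightarrow> 'f) \<Rightarrow> 'f" where
  "inst4 L t p q q' r =
     subst L (\<lambda>v. case v of PVar _ x \<Rightarrow> p x
                          | QVar i x \<Rightarrow> (if i = 1 then q x else q' x)
                          | RVar _ x \<Rightarrow> r x) t"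

definition Ext :: "('x, 'f, 'm) modal_logic_scheme \<Rightarrow> 'x pqr_var set \<Rightarrow> 'f \<Rightarrow> 'f set" where
  "Ext L V a = {b. vars L b \<subseteq> V \<and> entails L b a}"

definition local_transition_terms ::
  "('x, 'f, 'm) modal_logic_scheme \<Rightarrow> 'x set \<Rightarrow> 'x set \<Rightarrow> 'x set \<Rightarrow> 'f \<Rightarrow> 'f \<Rightarrow> ('x \<Rightarrow> 'f) \<Rightarrow> bool" where
  "local_transition_terms L P Q R \<beta> \<gamma> \<xi> \<longleftrightarrow>
     (\<forall>r\<in>R. vars L (\<xi> r) \<subseteq> PVar 0 ` P \<union> QVar 1 ` Q \<union> QVar 2 ` Q \<union> RVar 0 ` R) \<and>
     \<comment> \<open>compatibility\<close>
     entails L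
       (cnj L (inst3 L \<gamma> (pv L 0) (qv L 1) (rv L 0)) (inst2 L \<beta> (pv L 0) (qv L 2)))
       (inst3 L \<gamma> (pv L 0) (qv L 2) (\<lambda>r. inst4 L (\<xi> r) (pv L 0) (qv L 1) (qv L 2) (rv L 0))) \<and>
     \<comment> \<open>identity\<close>
     (\<forall>r\<in>R. entails L
       (inst3 L \<gamma> (pv L 0) (qv L 0) (rv L 0))
       (bicond L (rv L 0 r) (inst4 L (\<xi> r) (pv L 0) (qv L 0) (qv L 0) (rv L 0)))) \<and>
     \<comment> \<open>cocycle\<close>
     (\<forall>r\<in>R. entails L
       (cnj L (cnj L (inst3 L \<gamma> (pv L 0) (qv L 1) (rv L 0)) (inst2 L \<beta> (pv L 0) (qv L 2)))
               (inst2 L \<beta> (pv L 0) (qv L 3)))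
       (bicond L (inst4 L (\<xi> r) (pv L 0) (qv L 1) (qv L 3) (rv L 0))
              (inst4 L (\<xi> r) (pv L 0) (qv L 2) (qv L 3)
                 (\<lambda>s. inst4 L (\<xi> s) (pv L 0) (qv L 1) (qv L 2) (rv L 0)))))"

definition local_coequivalence ::
  "('x, 'f, 'm) modal_logic_scheme \<Rightarrow> 'x set \<Rightarrow> 'x set \<Rightarrow> 'f \<Rightarrow> ('x \<Rightarrow> 'f) \<Rightarrow> 'f" where
  "local_coequivalence L P R \<gamma> \<xi> =
     cnj L
       (cnj L
         (cnj L (inst3 L \<gamma> (pv L 1) (qv L 1) (rv L 1)) (inst3 L \<gamma> (pv L 2) (qv L 2) (rv L 2)))
         (bigcnj L ((\<lambda>p. bicond L (pv L 1 p) (pv L 2 p)) ` P)))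
       (bigcnj L
         ((\<lambda>r. bicond L (inst4 L (\<xi> r) (pv L 1) (qv L 1) (qv L 2) (rv L 1)) (rv L 2 r)) ` R))"

definition separates_variables ::
  "('x, 'f, 'm) modal_logic_scheme \<Rightarrow> 'x set \<Rightarrow> 'x set \<Rightarrow> 'x set \<Rightarrow> 'f \<Rightarrow> ('x \<Rightarrow> 'f) \<Rightarrow> bool" where
  "separates_variables L P Q R \<gamma> \<xi> \<longleftrightarrow>
     (\<exists>\<Psi>. family L \<Psi> \<and> (\<forall>\<psi>\<in>\<Psi>. vars L \<psi> \<subseteq> PVar 0 ` P \<union> QVar 0 ` Q \<union> RVar 0 ` R) \<and>
        (let \<rho> = local_coequivalence L P R \<gamma> \<xi>;
             \<sigma> = cnj L
                   (cnj L (inst3 L \<gamma> (pv L 1) (qv L 1) (rv L 1))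
                           (inst3 L \<gamma> (pv L 2) (qv L 2) (rv L 2)))
                   (bigcnj L
                     ((\<lambda>\<psi>. bicond L (inst3 L \<psi> (pv L 1) (qv L 1) (rv L 1))
                                 (inst3 L \<psi> (pv L 2) (qv L 2) (rv L 2))) ` \<Psi>))
         in entails L \<rho> \<sigma> \<and> entails L \<sigma> \<rho>))"

definition LCoSP :: "('x, 'f, 'm) modal_logic_scheme \<Rightarrow> bool" where
  "LCoSP L \<longleftrightarrow>
     (\<forall>P Q R \<alpha> \<beta> \<gamma> \<xi>.
        tuple L P \<longrightarrow> tuple L Q \<longrightarrow> tuple L R \<longrightarrow>
        vars L \<alpha> \<subseteq> PVar 0 ` P \<longrightarrow>
        \<beta> \<in> Ext L (PVar 0 ` P \<union> QVar 0 ` Q) \<alpha> \<longrightarrow>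
        \<gamma> \<in> Ext L (PVar 0 ` P \<union> QVar 0 ` Q \<union> RVar 0 ` R) \<beta> \<longrightarrow>
        local_transition_terms L P Q R \<beta> \<gamma> \<xi> \<longrightarrow>
        separates_variables L P Q R \<gamma> \<xi>)"


section \<open>The modal logic S5\<close>

datatype 'v fm = Var 'v | Bot | Neg "'v fm" | And "'v fm" "'v fm" | Box "'v fm"

definition Imp :: "'v fm \<Rightarrow> 'v fm \<Rightarrow> 'v fm" where
  "Imp \<phi> \<psi> = Neg (And \<phi> (Neg \<psi>))"

definition Dia :: "'v fm \<Rightarrow> 'v fm" where
  "Dia \<phi> = Neg (Box (Neg \<phi>))"

primrec fm_vars :: "'v fm \<Rightarrow> 'v set" where
  "fm_vars (Var v) = {v}"
| "fm_vars Bot = {}"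
| "fm_vars (Neg \<phi>) = fm_vars \<phi>"
| "fm_vars (And \<phi> \<psi>) = fm_vars \<phi> \<union> fm_vars \<psi>"
| "fm_vars (Box \<phi>) = fm_vars \<phi>"

primrec fm_subst :: "('v \<Rightarrow> 'w fm) \<Rightarrow> 'v fm \<Rightarrow> 'w fm" where
  "fm_subst \<sigma> (Var v) = \<sigma> v"
| "fm_subst \<sigma> Bot = Bot"
| "fm_subst \<sigma> (Neg \<phi>) = Neg (fm_subst \<sigma> \<phi>)"
| "fm_subst \<sigma> (And \<phi> \<psi>) = And (fm_subst \<sigma> \<phi>) (fm_subst \<sigma> \<psi>)"
| "fm_subst \<sigma> (Box \<phi>) = Box (fm_subst \<sigma> \<phi>)"

text \<open>Propositional evaluation: \<open>h\<close> assigns truth values to the variables and to the boxed formulas.\<close>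

primrec prop_eval :: "('v fm \<Rightarrow> bool) \<Rightarrow> 'v fm \<Rightarrow> bool" where
  "prop_eval h (Var v) \<longleftrightarrow> h (Var v)"
| "prop_eval h Bot \<longleftrightarrow> False"
| "prop_eval h (Neg \<phi>) \<longleftrightarrow> \<not> prop_eval h \<phi>"
| "prop_eval h (And \<phi> \<psi>) \<longleftrightarrow> prop_eval h \<phi> \<and> prop_eval h \<psi>"
| "prop_eval h (Box \<phi>) \<longleftrightarrow> h (Box \<phi>)"

text \<open>All substitution instances of the axioms.\<close>

inductive S5_axiom :: "'v fm \<Rightarrow> bool" where
  taut: "(\<And>h. prop_eval h \<phi>) \<Longrightarrow> S5_axiom \<phi>"
| K: "S5_axiom (Imp (Box (Imp \<phi> \<psi>)) (Imp (Box \<phi>) (Box \<psi>)))"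
| T: "S5_axiom (Imp (Box \<phi>) \<phi>)"
| Five: "S5_axiom (Imp (Dia \<phi>) (Box (Dia \<phi>)))"

inductive S5_derives :: "'v fm \<Rightarrow> 'v fm \<Rightarrow> bool" for \<alpha> where
  premise: "S5_derives \<alpha> \<alpha>"
| axiom: "S5_axiom \<phi> \<Longrightarrow> S5_derives \<alpha> \<phi>"
| MP: "S5_derives \<alpha> (Imp \<phi> \<psi>) \<Longrightarrow> S5_derives \<alpha> \<phi> \<Longrightarrow> S5_derives \<alpha> \<psi>"
| Nec: "S5_derives \<alpha> \<phi> \<Longrightarrow> S5_derives \<alpha> (Box \<phi>)"

text \<open>
  The conjunction of a finite set of formulas, in an arbitrary order; the order and the bracketing
  matter only up to interderivability.
\<close>

definition fm_bigconj :: "'v fm set \<Rightarrow> 'v fm" where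
  "fm_bigconj S = foldr And (SOME \<phi>s. set \<phi>s = S) (Neg Bot)"

definition S5 :: "('x, 'x pqr_var fm) modal_logic" where
  "S5 = \<lparr> atom = Var, neg = Neg, cnj = And, bigcnj = fm_bigconj,
          vars = fm_vars, subst = fm_subst, entails = S5_derives,
          tuple = finite, family = finite \<rparr>"


section \<open>The infinitary extension of S5\<close>

text \<open>
  \<open>IConj I f\<close> is the conjunction of the set of formulas \<open>f ` I\<close>; the values of \<open>f\<close> outside \<open>I\<close> are
  irrelevant.  The sets of formulas that have a conjunction are those with at most as many elements
  as the type \<open>'k\<close>, which has to be chosen large enough: by Cantor's theorem no type
  of formulas is closed under conjunctions of arbitrary sets of its elements.
\<close>

datatype ('v, 'k) ifm =
    IVar 'v
  | INeg "('v, 'k) ifm"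
  | IConj "'k set" "'k \<Rightarrow> ('v, 'k) ifm"
  | IBox "('v, 'k) ifm"

primrec ifm_vars :: "('v, 'k) ifm \<Rightarrow> 'v set" where
  "ifm_vars (IVar v) = {v}"
| "ifm_vars (INeg \<phi>) = ifm_vars \<phi>"
| "ifm_vars (IConj I f) = (\<Union>i\<in>I. ifm_vars (f i))"
| "ifm_vars (IBox \<phi>) = ifm_vars \<phi>"

primrec ifm_subst :: "('v \<Rightarrow> ('w, 'k) ifm) \<Rightarrow> ('v, 'k) ifm \<Rightarrow> ('w, 'k) ifm" where
  "ifm_subst \<sigma> (IVar v) = \<sigma> v"
| "ifm_subst \<sigma> (INeg \<phi>) = INeg (ifm_subst \<sigma> \<phi>)"
| "ifm_subst \<sigma> (IConj I f) = IConj I (\<lambda>i. ifm_subst \<sigma> (f i))"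
| "ifm_subst \<sigma> (IBox \<phi>) = IBox (ifm_subst \<sigma> \<phi>)"

primrec sat :: "('w \<times> 'w) set \<Rightarrow> ('v \<Rightarrow> 'w set) \<Rightarrow> 'w \<Rightarrow> ('v, 'k) ifm \<Rightarrow> bool" where
  "sat E V w (IVar v) \<longleftrightarrow> w \<in> V v"
| "sat E V w (INeg \<phi>) \<longleftrightarrow> \<not> sat E V w \<phi>"
| "sat E V w (IConj I f) \<longleftrightarrow> (\<forall>i\<in>I. sat E V w (f i))"
| "sat E V w (IBox \<phi>) \<longleftrightarrow> (\<forall>u. (w, u) \<in> E \<longrightarrow> sat E V u \<phi>)"

definition locally_finite_S5_frame :: "'w set \<Rightarrow> ('w \<times> 'w) set \<Rightarrow> bool" where
  "locally_finite_S5_frame W E \<longleftrightarrow> equiv W E \<and> (\<forall>C \<in> W // E. finite C)"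

text \<open>
  Consequence over the locally finite frames whose points are taken from the type \<open>'w\<close>.  All
  infinite types give the same relation, see \<open>ifm_entails_world_type\<close> below.
\<close>

definition ifm_entails :: "'w itself \<Rightarrow> ('v, 'k) ifm \<Rightarrow> ('v, 'k) ifm \<Rightarrow> bool" where
  "ifm_entails _ \<alpha> \<beta> \<longleftrightarrow>
     (\<forall>(W :: 'w set) E V. locally_finite_S5_frame W E \<longrightarrow> (\<forall>v. V v \<subseteq> W) \<longrightarrow>
        (\<forall>w\<in>W. sat E V w \<alpha>) \<longrightarrow> (\<forall>w\<in>W. sat E V w \<beta>))"

definition ifm_family :: "('v, 'k) ifm set \<Rightarrow> bool" where
  "ifm_family S \<longleftrightarrow> (\<exists>I f. S = f ` (I :: 'k set))"

text \<open>Meaningful for sets \<open>S\<close> with \<open>ifm_family S\<close>; the choice of the indexing is immaterial.\<close>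

definition ifm_bigconj :: "('v, 'k) ifm set \<Rightarrow> ('v, 'k) ifm" where
  "ifm_bigconj S = (SOME \<phi>. \<exists>I f. \<phi> = IConj I f \<and> S = f ` I)"

definition S5_inf :: "'w itself \<Rightarrow> ('x, ('x pqr_var, 'k) ifm) modal_logic" where
  "S5_inf w = \<lparr> atom = IVar, neg = INeg, cnj = (\<lambda>\<phi> \<psi>. ifm_bigconj {\<phi>, \<psi>}),
                bigcnj = ifm_bigconj, vars = ifm_vars, subst = ifm_subst,
                entails = ifm_entails w, tuple = (\<lambda>_. True), family = ifm_family \<rparr>"

lemma ifm_bigconj_eq:
  assumes "ifm_family S"
  shows "\<exists>I f. ifm_bigconj S = IConj I f \<and> S = f ` I"
proof -
  have "\<exists>\<phi> I f. \<phi> = IConj I f \<and> S = f ` I"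
    using assms unfolding ifm_family_def by blast
  then show ?thesis
    unfolding ifm_bigconj_def by (rule someI_ex)
qed

lemma sat_ifm_bigconj: "ifm_family S \<Longrightarrow> sat E V w (ifm_bigconj S) \<longleftrightarrow> (\<forall>\<phi>\<in>S. sat E V w \<phi>)"
  using ifm_bigconj_eq[of S] by auto

lemma ifm_family_iff: "ifm_family (S :: ('v, 'k) ifm set) \<longleftrightarrow> (\<exists>h :: _ \<Rightarrow> 'k. inj_on h S)"
proof
  assume "ifm_family S"
  then obtain f and I :: "'k set" where "S = f ` I"
    unfolding ifm_family_def by blast
  then show "\<exists>h :: _ \<Rightarrow> 'k. inj_on h S"
    using inj_on_inv_into[of S f I] by blast
next
  assume "\<exists>h :: _ \<Rightarrow> 'k. inj_on h S"
  then obtain h :: "_ \<Rightarrow> 'k" where "inj_on h S" ..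
  then have "S = inv_into S h ` (h ` S)"
    by simp
  then show "ifm_family S"
    unfolding ifm_family_def by blast
qed

lemma sat_transfer:
  fixes g :: "'a \<Rightarrow> 'b"
  assumes E: "equiv W E" and w: "w \<in> W" and g: "inj_on g (E `` {w})"
    and F: "F = g ` (E `` {w}) \<times> g ` (E `` {w})"
    and u: "u \<in> E `` {w}"
  shows "sat F (\<lambda>v. g ` (V v \<inter> E `` {w})) (g u) \<phi> \<longleftrightarrow> sat E V u \<phi>"
  using u
proof (induction \<phi> arbitrary: u)
  case (IVar v)
  then show ?case
    using inj_on_image_mem_iff[OF g, of u "V v \<inter> E `` {w}"] by simp
next
  case (IBox \<phi>)
  have "E `` {u} = E `` {w}"
    using equiv_class_eq[OF E, of w u] IBox.prems by simp
  then have "(u, u') \<in> E \<longleftrightarrow> u' \<in> E `` {w}" for u'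
    by blast
  then have "sat E V u (IBox \<phi>) \<longleftrightarrow> (\<forall>u'\<in>E `` {w}. sat E V u' \<phi>)"
    by auto
  also have "\<dots> \<longleftrightarrow> (\<forall>u'\<in>E `` {w}. sat F (\<lambda>v. g ` (V v \<inter> E `` {w})) (g u') \<phi>)"
    using IBox.IH by simp
  also have "\<dots> \<longleftrightarrow> sat F (\<lambda>v. g ` (V v \<inter> E `` {w})) (g u) (IBox \<phi>)"
    using IBox.prems unfolding F by auto
  finally show ?case ..
qed simp_all

lemma ifm_entails_world_type_aux:
  fixes \<alpha> \<beta> :: "('v, 'k) ifm"
  assumes inf: "infinite (UNIV :: 'b set)" and ent: "ifm_entails TYPE('b) \<alpha> \<beta>"
  shows "ifm_entails TYPE('a) \<alpha> \<beta>"
  unfolding ifm_entails_def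
proof (intro allI impI ballI)
  fix W :: "'a set" and E V w
  assume fr: "locally_finite_S5_frame W E" and \<alpha>: "\<forall>w\<in>W. sat E V w \<alpha>" and w: "w \<in> W"
  let ?C = "E `` {w}"
  have E: "equiv W E" and fin: "finite ?C"
    using fr w unfolding locally_finite_S5_frame_def quotient_def by auto
  have CW: "?C \<subseteq> W" and wC: "w \<in> ?C"
    using E w by (auto simp: equiv_def refl_on_def)
  obtain B :: "'b set" where "finite B" "card B = card ?C"
    using infinite_arbitrarily_large[OF inf] by blast
  then obtain g where g: "bij_betw g ?C B"
    using finite_same_card_bij[OF fin] by metis
  let ?W = "g ` ?C" and ?F = "g ` ?C \<times> g ` ?C" and ?V = "\<lambda>v. g ` (V v \<inter> ?C)"
  have tr: "sat ?F ?V (g u) \<phi> \<longleftrightarrow> sat E V u \<phi>" if "u \<in> ?C" for u and \<phi> :: "('v, 'k) ifm"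
    by (rule sat_transfer[OF E w bij_betw_imp_inj_on[OF g] refl that])
  have "equiv ?W ?F"
    by (auto simp: equiv_def refl_on_def sym_on_def trans_on_def)
  moreover have "finite C" if "C \<in> ?W // ?F" for C
  proof -
    have "C \<subseteq> ?W" using that by (auto simp: quotient_def)
    then show ?thesis using fin finite_subset by blast
  qed
  ultimately have "locally_finite_S5_frame ?W ?F"
    unfolding locally_finite_S5_frame_def by simp
  moreover have "\<forall>v. ?V v \<subseteq> ?W"
    by blast
  moreover have "\<forall>x\<in>?W. sat ?F ?V x \<alpha>"
  proof
    fix x assume "x \<in> ?W"
    then obtain u where u: "u \<in> ?C" "x = g u" by blast
    then have "u \<in> W" using CW by (rule_tac subsetD)
    then have "sat E V u \<alpha>" using \<alpha> by simp
    then show "sat ?F ?V x \<alpha>" using tr[OF u(1), of \<alpha>] u(2) by simp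
  qed
  ultimately have "\<forall>x\<in>?W. sat ?F ?V x \<beta>"
    using ent[unfolded ifm_entails_def, THEN spec[of _ ?W], THEN spec[of _ ?F], THEN spec[of _ ?V]]
    by (elim impE)
  then have "sat ?F ?V (g w) \<beta>"
    using wC by simp
  then show "sat E V w \<beta>"
    using tr[OF wC, of \<beta>] by simp
qed

lemma ifm_entails_world_type:
  assumes "infinite (UNIV :: 'a set)" and "infinite (UNIV :: 'b set)"
  shows "ifm_entails TYPE('a) \<alpha> \<beta> \<longleftrightarrow> ifm_entails TYPE('b) \<alpha> \<beta>"
  by (rule iffI) (rule ifm_entails_world_type_aux[OF assms(2)] ifm_entails_world_type_aux[OF assms(1)],
      assumption)+

end

theory Submission
  imports Defs
begin

text \<open>
  On a finite cluster, transition terms give coherent bijections between the solution sets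
  \<open>{r. \<gamma>(p,q,r)}\<close> for all solutions \<open>q\<close> of \<open>\<beta>(p,q)\<close>. Were there a solution \<open>q\<close>
  definable from \<open>p\<close>, transporting \<open>r\<close> to it would give a complete
  invariant of the class of \<open>(p,q,r)\<close>. In general there is none, but truth is invariant under
  bisimulation, so every point may be replaced by several copies: over the cluster of pairs \<open>(w,u)\<close>
  with \<open>(p(w),u)\<close> in a set \<open>U\<close> of valuations that satisfies \<open>\<beta>\<close> and depends only on the
  valuations of \<open>p\<close>, the second component is a canonical solution. Transporting \<open>r\<close> to it
  yields a complete invariant that assigns to \<open>w\<close> the set of pairs of \<open>u\<close> and the transported
  value at \<open>(w,u)\<close>. It depends only on the pointed model, and over finite clusters every property
  of pointed models is defined by a formula.
\<close>

section \<open>Finite cluster semantics\<close>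

text \<open>Plays two roles: applied to the full tuples it is the set of available variables;
  applied to subsets of them it is the valuation that makes exactly these variables true.\<close>

definition pqr_vars :: "'x set \<Rightarrow> 'x set \<Rightarrow> 'x set \<Rightarrow> 'x pqr_var set" where
  "pqr_vars P Q R = PVar 0 ` P \<union> QVar 0 ` Q \<union> RVar 0 ` R"

definition pqqr_vars :: "'x set \<Rightarrow> 'x set \<Rightarrow> 'x set \<Rightarrow> 'x set \<Rightarrow> 'x pqr_var set" where
  "pqqr_vars P Q Q' R = PVar 0 ` P \<union> QVar 1 ` Q \<union> QVar 2 ` Q' \<union> RVar 0 ` R"

definition p_part :: "'x pqr_var set \<Rightarrow> 'x set" where
  "p_part s = {x. PVar 0 x \<in> s}"

definition q_part :: "'x pqr_var set \<Rightarrow> 'x set" where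
  "q_part s = {x. QVar 0 x \<in> s}"

definition r_part :: "'x pqr_var set \<Rightarrow> 'x set" where
  "r_part s = {x. RVar 0 x \<in> s}"

lemma parts_pqr_vars [simp]:
  "p_part (pqr_vars p q r) = p" "q_part (pqr_vars p q r) = q" "r_part (pqr_vars p q r) = r"
  by (auto simp: p_part_def q_part_def r_part_def pqr_vars_def)

lemma pqr_vars_parts:
  assumes "s \<subseteq> pqr_vars P Q R"
  shows "pqr_vars (p_part s) (q_part s) (r_part s) = s"
  using assms by (auto simp: p_part_def q_part_def r_part_def pqr_vars_def)

lemma pqr_vars_eq_iff: "pqr_vars p q r = pqr_vars p' q' r' \<longleftrightarrow> p = p' \<and> q = q' \<and> r = r'"
  by (metis parts_pqr_vars)

lemma pqr_vars_mono:
  "p \<subseteq> P \<Longrightarrow> q \<subseteq> Q \<Longrightarrow> r \<subseteq> R \<Longrightarrow> pqr_vars p q r \<subseteq> pqr_vars P Q R"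
  by (auto simp: pqr_vars_def)

text \<open>\<open>S\<close> is finite even when \<open>X\<close> is infinite. This keeps the number
  of pointed models small enough for the conjunctions indexed by them.\<close>

definition pointed_models :: "'v set \<Rightarrow> ('v set set \<times> 'v set) set" where
  "pointed_models X = {(S, s). finite S \<and> S \<subseteq> Pow X \<and> s \<in> S}"

text \<open>
  A model on a finite cluster is represented by the finite set \<open>S\<close> of the valuations of its points,
  a valuation being the set of variables that are true.  Points with the same valuation satisfy the
  same formulas, so nothing is lost.
\<close>

locale cluster_semantics =
  fixes L :: "('x, 'f) modal_logic"
    and box :: "'f \<Rightarrow> 'f"
    and ev :: "'f \<Rightarrow> 'x pqr_var set set \<Rightarrow> 'x pqr_var set \<Rightarrow> bool"
  assumes ev_atom: "ev (atom L v) S s \<longleftrightarrow> v \<in> s"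
    and ev_neg: "ev (neg L a) S s \<longleftrightarrow> \<not> ev a S s"
    and ev_cnj: "ev (cnj L a b) S s \<longleftrightarrow> ev a S s \<and> ev b S s"
    and ev_box: "ev (box a) S s \<longleftrightarrow> (\<forall>t\<in>S. ev a S t)"
    and ev_bigcnj: "family L A \<Longrightarrow> ev (bigcnj L A) S s \<longleftrightarrow> (\<forall>a\<in>A. ev a S s)"
    and vars_atom: "vars L (atom L v) = {v}"
    and vars_neg: "vars L (neg L a) = vars L a"
    and vars_box: "vars L (box a) = vars L a"
    and vars_bigcnj: "family L A \<Longrightarrow> vars L (bigcnj L A) = (\<Union>a\<in>A. vars L a)"
    and ev_subst: "ev (subst L \<sigma> a) S s \<longleftrightarrow>
      ev a ((\<lambda>t. {v. ev (\<sigma> v) S t}) ` S) {v. ev (\<sigma> v) S s}"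
    and ev_restrict: "vars L a \<subseteq> X \<Longrightarrow> ev a ((\<lambda>t. t \<inter> X) ` S) (s \<inter> X) \<longleftrightarrow> ev a S s"
    and entails_iff: "entails L a b \<longleftrightarrow>
      (\<forall>S. finite S \<longrightarrow> (\<forall>s\<in>S. ev a S s) \<longrightarrow> (\<forall>s\<in>S. ev b S s))"
    and family_finite: "finite A \<Longrightarrow> family L A"
    and family_subset: "family L A \<Longrightarrow> B \<subseteq> A \<Longrightarrow> family L B"
    and family_models: "tuple L P \<Longrightarrow> tuple L Q \<Longrightarrow> tuple L R \<Longrightarrow>
      family L (f ` pointed_models (pqr_vars P Q R))"
begin

section \<open>Sizes of the conjunctions that are used\<close>

lemma family_Pow:
  assumes "tuple L P" "tuple L Q" "tuple L R"
  shows "family L (f ` Pow (pqr_vars P Q R))"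
proof (rule family_subset[OF family_models[OF assms, of "f \<circ> snd"]])
  show "f ` Pow (pqr_vars P Q R) \<subseteq> (f \<circ> snd) ` pointed_models (pqr_vars P Q R)"
  proof
    fix y assume "y \<in> f ` Pow (pqr_vars P Q R)"
    \<comment> \<open>One-point clusters embed the power set into the pointed models.\<close>
    then obtain s where "s \<subseteq> pqr_vars P Q R" "y = (f \<circ> snd) ({s}, s)" by auto
    then show "y \<in> (f \<circ> snd) ` pointed_models (pqr_vars P Q R)"
      by (intro image_eqI[of _ _ "({s}, s)"]) (auto simp: pointed_models_def)
  qed
qed

lemma family_vars:
  assumes "tuple L P" "tuple L Q" "tuple L R"
  shows "family L (f ` pqr_vars P Q R)"
proof (rule family_subset[OF family_Pow[OF assms, of "f \<circ> the_elem"]])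
  show "f ` pqr_vars P Q R \<subseteq> (f \<circ> the_elem) ` Pow (pqr_vars P Q R)"
  proof
    fix y assume "y \<in> f ` pqr_vars P Q R"
    then obtain v where "v \<in> pqr_vars P Q R" "y = (f \<circ> the_elem) {v}" by auto
    then show "y \<in> (f \<circ> the_elem) ` Pow (pqr_vars P Q R)"
      by (intro image_eqI[of _ _ "{v}"]) auto
  qed
qed

lemma family_tuple:
  assumes "tuple L P" "tuple L Q" "tuple L R"
  shows "family L (f ` P)" "family L (f ` R)"
  by (rule family_subset[OF family_vars[OF assms,
          of "case_pqr_var (\<lambda>_. f) (\<lambda>_. f) (\<lambda>_. f)"]], force simp: pqr_vars_def image_iff)+

lemma ev_bicond: "ev (bicond L a b) S s \<longleftrightarrow> (ev a S s \<longleftrightarrow> ev b S s)"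
  by (auto simp: bicond_def ev_cnj ev_neg)

section \<open>Definability of properties of pointed models\<close>

definition disj :: "'f set \<Rightarrow> 'f" where
  "disj A = neg L (bigcnj L (neg L ` A))"

lemma ev_disj: "family L (neg L ` A) \<Longrightarrow> ev (disj A) S s \<longleftrightarrow> (\<exists>a\<in>A. ev a S s)"
  by (simp add: disj_def ev_neg ev_bigcnj)

lemma vars_disj: "family L (neg L ` A) \<Longrightarrow> vars L (disj A) = (\<Union>a\<in>A. vars L a)"
  by (simp add: disj_def vars_neg vars_bigcnj)

text \<open>A characteristic formula describes a pointed model over \<open>X\<close> completely:
  which valuations occur on the cluster and which one holds at the point. The property
  \<open>F\<close> is defined by the disjunction of the characteristic formulas of the models that
  have it.\<close>

lemma definable:
  assumes t: "tuple L P" "tuple L Q" "tuple L R"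
  defines "X \<equiv> pqr_vars P Q R"
  shows "\<exists>a. vars L a \<subseteq> X \<and>
    (\<forall>S s. finite S \<longrightarrow> s \<in> S \<longrightarrow> (ev a S s \<longleftrightarrow> F ((\<lambda>t. t \<inter> X) ` S) (s \<inter> X)))"
proof -
  define lit where "lit s = bigcnj L ((\<lambda>v. if v \<in> s then atom L v else neg L (atom L v)) ` X)" for s
  have famX: "family L (f ` X)" for f
    unfolding X_def by (rule family_vars[OF t])
  have ev_lit: "ev (lit s) S u \<longleftrightarrow> u \<inter> X = s" if "s \<subseteq> X" for s S u
  proof -
    have "ev (lit s) S u \<longleftrightarrow> (\<forall>v\<in>X. v \<in> s \<longleftrightarrow> v \<in> u)"
      unfolding lit_def ev_bigcnj[OF famX] ball_simps by (auto simp: ev_atom ev_neg)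
    then show ?thesis using that by blast
  qed
  have vars_lit: "vars L (lit s) \<subseteq> X" for s
    unfolding lit_def vars_bigcnj[OF famX] by (auto simp: vars_atom vars_neg)
  \<comment> \<open>The three kinds of conjuncts fix the valuation of the point, exclude valuations
    outside \<open>S\<close>, and force each member of \<open>S\<close> to occur.\<close>
  define parts where "parts S s = insert (lit s) (insert (box (disj (lit ` S)))
      ((\<lambda>t. neg L (box (neg L (lit t)))) ` S))" for S s
  define char where "char m = bigcnj L (parts (fst m) (snd m))" for m
  have famp: "family L (parts S s)" if "finite S" for S s
    using that by (intro family_finite) (simp add: parts_def)
  have famd: "family L (neg L ` lit ` S)" if "finite S" for S
    using that by (intro family_finite) simp
  have ev_char: "ev (char (S, s)) T u \<longleftrightarrow> (\<lambda>t. t \<inter> X) ` T = S \<and> u \<inter> X = s"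
    if m: "(S, s) \<in> pointed_models X" for S s T u
  proof -
    have SX: "t \<subseteq> X" if "t \<in> S" for t
      using m that by (auto simp: pointed_models_def)
    have fin: "finite S" and sX: "s \<in> S"
      using m by (auto simp: pointed_models_def)
    have "ev (char (S, s)) T u \<longleftrightarrow> u \<inter> X = s \<and> (\<forall>t\<in>T. \<exists>t'\<in>S. t \<inter> X = t') \<and>
        (\<forall>t'\<in>S. \<exists>t\<in>T. t \<inter> X = t')"
      using ev_lit[OF SX] sX
      by (simp add: char_def ev_bigcnj[OF famp[OF fin]], simp add: parts_def ev_box
          ev_disj[OF famd[OF fin]] ev_neg)
    also have "\<dots> \<longleftrightarrow> (\<lambda>t. t \<inter> X) ` T = S \<and> u \<inter> X = s"
      unfolding set_eq_subset[of _ S] image_subset_iff subset_iff[of S] image_iff by metis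
    finally show ?thesis .
  qed
  have vars_char: "vars L (char (S, s)) \<subseteq> X" if m: "(S, s) \<in> pointed_models X" for S s
  proof -
    have fin: "finite S" using m by (auto simp: pointed_models_def)
    show ?thesis
      using subsetD[OF vars_lit]
      by (auto simp add: char_def vars_bigcnj[OF famp[OF fin]])
        (auto simp: parts_def vars_box vars_disj[OF famd[OF fin]] vars_neg)
  qed
  define I where "I = {m \<in> pointed_models X. F (fst m) (snd m)}"
  \<comment> \<open>Here the bound on the number of pointed models enters: it makes the disjunction
    over \<open>I\<close> admissible.\<close>
  have famI: "family L (neg L ` char ` I)"
    by (rule family_subset[OF family_models[OF t, of "neg L \<circ> char"]]) (auto simp: I_def X_def)
  have "ev (disj (char ` I)) S s \<longleftrightarrow> F ((\<lambda>t. t \<inter> X) ` S) (s \<inter> X)"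
    if "finite S" "s \<in> S" for S s
  proof -
    have "((\<lambda>t. t \<inter> X) ` S, s \<inter> X) \<in> pointed_models X"
      using that by (auto simp: pointed_models_def)
    then have "(\<exists>m\<in>I. ev (char m) S s) \<longleftrightarrow> F ((\<lambda>t. t \<inter> X) ` S) (s \<inter> X)"
      using ev_char unfolding I_def by (metis (no_types, lifting) mem_Collect_eq prod.collapse
          fst_conv snd_conv)
    then show ?thesis
      by (simp add: ev_disj[OF famI])
  qed
  moreover have "vars L (disj (char ` I)) \<subseteq> X"
    unfolding vars_disj[OF famI] by (auto simp: I_def dest: subsetD[OF vars_char])
  ultimately show ?thesis by blast
qed

text \<open>The points \<open>W\<close> are kept apart from their valuations, so that several tuples
  can be read on one cluster and clusters can be pulled back along maps of points.\<close>

definition valid :: "'f \<Rightarrow> 'w set \<Rightarrow> ('w \<Rightarrow> 'x pqr_var set) \<Rightarrow> bool" where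
  "valid c W a \<longleftrightarrow> (\<forall>w\<in>W. ev c (a ` W) (a w))"

lemma entailsD: "entails L b c \<Longrightarrow> finite W \<Longrightarrow> valid b W a \<Longrightarrow> valid c W a"
  unfolding entails_iff valid_def by blast

lemma entails_validI:
  assumes "\<And>S. finite S \<Longrightarrow> valid b S id \<Longrightarrow> valid c S id"
  shows "entails L b c"
  using assms unfolding entails_iff valid_def by simp

lemma valid_cnj: "valid (cnj L b c) W a \<longleftrightarrow> valid b W a \<and> valid c W a"
  by (auto simp: valid_def ev_cnj)

text \<open>This is invariance under bisimulation: replacing each point by several copies with the
  same valuation leaves the set of occurring valuations unchanged.\<close>

lemma valid_image: "valid c (h ` W) a \<longleftrightarrow> valid c W (a \<circ> h)"
  by (auto simp: valid_def image_image)

text \<open>Evaluating a substitution instance amounts to relabelling the points by the truth sets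
  of the substituted formulas. Names outside the tuples are cut off by \<open>ev_restrict\<close>,
  whence the intersections.\<close>

lemma ev_inst3:
  assumes "vars L c \<subseteq> pqr_vars P Q R"
    and "\<And>u. u \<in> W \<Longrightarrow> P \<inter> {x. ev (fp x) (a ` W) (a u)} = p u"
    and "\<And>u. u \<in> W \<Longrightarrow> Q \<inter> {x. ev (fq x) (a ` W) (a u)} = q u"
    and "\<And>u. u \<in> W \<Longrightarrow> R \<inter> {x. ev (fr x) (a ` W) (a u)} = r u"
    and w: "w \<in> W"
  shows "ev (inst3 L c fp fq fr) (a ` W) (a w) \<longleftrightarrow>
    ev c ((\<lambda>u. pqr_vars (p u) (q u) (r u)) ` W) (pqr_vars (p w) (q w) (r w))"
proof -
  define \<sigma> where "\<sigma> v = (case v of PVar _ x \<Rightarrow> fp x | QVar _ x \<Rightarrow> fq x | RVar _ x \<Rightarrow> fr x)"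
    for v :: "'x pqr_var"
  have *: "{v. ev (\<sigma> v) (a ` W) (a u)} \<inter> pqr_vars P Q R = pqr_vars (p u) (q u) (r u)"
    if "u \<in> W" for u
    using assms(2-4)[OF that, symmetric] by (auto simp: pqr_vars_def \<sigma>_def)
  have "ev (inst3 L c fp fq fr) (a ` W) (a w) \<longleftrightarrow>
      ev c ((\<lambda>u. {v. ev (\<sigma> v) (a ` W) (a u)}) ` W) {v. ev (\<sigma> v) (a ` W) (a w)}"
    unfolding inst3_def ev_subst \<sigma>_def image_image ..
  also have "\<dots> \<longleftrightarrow> ev c ((\<lambda>u. {v. ev (\<sigma> v) (a ` W) (a u)} \<inter> pqr_vars P Q R) ` W)
      ({v. ev (\<sigma> v) (a ` W) (a w)} \<inter> pqr_vars P Q R)"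
    by (subst ev_restrict[OF assms(1), symmetric]) (simp only: image_image)
  also have "\<dots> \<longleftrightarrow> ev c ((\<lambda>u. pqr_vars (p u) (q u) (r u)) ` W) (pqr_vars (p w) (q w) (r w))"
    using * w by (simp cong: image_cong)
  finally show ?thesis .
qed

lemma ev_inst4:
  assumes "vars L c \<subseteq> pqqr_vars P Q Q' R"
    and "\<And>u. u \<in> W \<Longrightarrow> P \<inter> {x. ev (fp x) (a ` W) (a u)} = p u"
    and "\<And>u. u \<in> W \<Longrightarrow> Q \<inter> {x. ev (fq x) (a ` W) (a u)} = q u"
    and "\<And>u. u \<in> W \<Longrightarrow> Q' \<inter> {x. ev (fq' x) (a ` W) (a u)} = q' u"
    and "\<And>u. u \<in> W \<Longrightarrow> R \<inter> {x. ev (fr x) (a ` W) (a u)} = r u"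
    and w: "w \<in> W"
  shows "ev (inst4 L c fp fq fq' fr) (a ` W) (a w) \<longleftrightarrow>
    ev c ((\<lambda>u. pqqr_vars (p u) (q u) (q' u) (r u)) ` W) (pqqr_vars (p w) (q w) (q' w) (r w))"
proof -
  define \<sigma> where "\<sigma> v = (case v of PVar _ x \<Rightarrow> fp x
      | QVar i x \<Rightarrow> (if i = 1 then fq x else fq' x) | RVar _ x \<Rightarrow> fr x)"
    for v :: "'x pqr_var"
  have *: "{v. ev (\<sigma> v) (a ` W) (a u)} \<inter> pqqr_vars P Q Q' R = pqqr_vars (p u) (q u) (q' u) (r u)"
    if "u \<in> W" for u
    using assms(2-5)[OF that, symmetric] by (auto simp: pqqr_vars_def \<sigma>_def)
  have "ev (inst4 L c fp fq fq' fr) (a ` W) (a w) \<longleftrightarrow>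
      ev c ((\<lambda>u. {v. ev (\<sigma> v) (a ` W) (a u)}) ` W) {v. ev (\<sigma> v) (a ` W) (a w)}"
    unfolding inst4_def ev_subst \<sigma>_def image_image ..
  also have "\<dots> \<longleftrightarrow> ev c ((\<lambda>u. {v. ev (\<sigma> v) (a ` W) (a u)} \<inter> pqqr_vars P Q Q' R) ` W)
      ({v. ev (\<sigma> v) (a ` W) (a w)} \<inter> pqqr_vars P Q Q' R)"
    by (subst ev_restrict[OF assms(1), symmetric]) (simp only: image_image)
  also have "\<dots> \<longleftrightarrow>
      ev c ((\<lambda>u. pqqr_vars (p u) (q u) (q' u) (r u)) ` W) (pqqr_vars (p w) (q w) (q' w) (r w))"
    using * w by (simp cong: image_cong)
  finally show ?thesis .
qed

lemma valid_inst3: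
  assumes "vars L c \<subseteq> pqr_vars P Q R"
    and "\<And>u. u \<in> W \<Longrightarrow> P \<inter> {x. ev (fp x) (a ` W) (a u)} = p u"
    and "\<And>u. u \<in> W \<Longrightarrow> Q \<inter> {x. ev (fq x) (a ` W) (a u)} = q u"
    and "\<And>u. u \<in> W \<Longrightarrow> R \<inter> {x. ev (fr x) (a ` W) (a u)} = r u"
  shows "valid (inst3 L c fp fq fr) W a \<longleftrightarrow> valid c W (\<lambda>w. pqr_vars (p w) (q w) (r w))"
  unfolding valid_def using ev_inst3[OF assms] by simp

lemma valid_inst2:
  assumes "vars L c \<subseteq> PVar 0 ` P \<union> QVar 0 ` Q"
    and "\<And>u. u \<in> W \<Longrightarrow> P \<inter> {x. ev (fp x) (a ` W) (a u)} = p u"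
    and "\<And>u. u \<in> W \<Longrightarrow> Q \<inter> {x. ev (fq x) (a ` W) (a u)} = q u"
  shows "valid (inst2 L c fp fq) W a \<longleftrightarrow> valid c W (\<lambda>w. pqr_vars (p w) (q w) {})"
  unfolding inst2_def
  \<comment> \<open>The third tuple is taken empty, which removes the default \<open>rv L 0\<close>
    of \<open>inst2\<close> from the resulting valuation.\<close>
  by (rule valid_inst3[of c P Q "{}"]) (use assms in \<open>auto simp: pqr_vars_def\<close>)

end

section \<open>The invariant of a local coequivalence\<close>

locale transition = cluster_semantics L box ev
  for L :: "('x, 'f) modal_logic" and box ev +
  fixes P Q R :: "'x set" and \<beta> \<gamma> :: 'f and \<xi> :: "'x \<Rightarrow> 'f"
  assumes tup: "tuple L P" "tuple L Q" "tuple L R"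
    and vars_\<beta>: "vars L \<beta> \<subseteq> PVar 0 ` P \<union> QVar 0 ` Q"
    and vars_\<gamma>: "vars L \<gamma> \<subseteq> pqr_vars P Q R"
    and \<gamma>_entails: "entails L \<gamma> \<beta>"
    and ltt: "local_transition_terms L P Q R \<beta> \<gamma> \<xi>"
begin

section \<open>Transport of r-tuples along the transition terms\<close>

lemma vars_\<xi>: "r \<in> R \<Longrightarrow> vars L (\<xi> r) \<subseteq> pqqr_vars P Q Q R"
  using ltt unfolding local_transition_terms_def pqqr_vars_def by blast

text \<open>The transition terms read on a cluster: a tuple \<open>r\<close> over \<open>q\<close>
  is carried to one over \<open>q'\<close>. A tuple of propositions is given as a function from
  points to the sets of true names.\<close>

definition transp where
  "transp W p q q' r w = {k \<in> R. ev (\<xi> k) ((\<lambda>u. pqqr_vars (p u) (q u) (q' u) (r u)) ` W)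
     (pqqr_vars (p w) (q w) (q' w) (r w))}"

abbreviation "sol_\<gamma> W p q r \<equiv> valid \<gamma> W (\<lambda>w. pqr_vars (p w) (q w) (r w))"
abbreviation "sol_\<beta> W p q \<equiv> valid \<beta> W (\<lambda>w. pqr_vars (p w) (q w) {})"

lemma transp_subset: "transp W p q q' r w \<subseteq> R"
  by (auto simp: transp_def)

lemma transp_image:
  "transp (h ` W) p q q' r (h w) = transp W (p \<circ> h) (q \<circ> h) (q' \<circ> h) (r \<circ> h) w"
  by (simp add: transp_def image_image)

lemma transp_cong:
  assumes "\<And>u. u \<in> W \<Longrightarrow> p u = p' u" "\<And>u. u \<in> W \<Longrightarrow> q1 u = q1' u"
    "\<And>u. u \<in> W \<Longrightarrow> q2 u = q2' u" "\<And>u. u \<in> W \<Longrightarrow> r u = r' u" and w: "w \<in> W"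
  shows "transp W p q1 q2 r w = transp W p' q1' q2' r' w"
proof -
  have "pqqr_vars (p u) (q1 u) (q2 u) (r u) = pqqr_vars (p' u) (q1' u) (q2' u) (r' u)"
    if "u \<in> W" for u
    using assms(1-4)[OF that] by simp
  from this this[OF w] show ?thesis
    unfolding transp_def by (simp cong: image_cong)
qed

text \<open>The formulas \<open>fr\<close> may themselves be transition terms, so nested
  substitution becomes composition of transports.\<close>

lemma transp_inst4:
  assumes "\<And>u. u \<in> W \<Longrightarrow> P \<inter> {x. ev (fp x) (a ` W) (a u)} = p u"
    and "\<And>u. u \<in> W \<Longrightarrow> Q \<inter> {x. ev (fq x) (a ` W) (a u)} = q u"
    and "\<And>u. u \<in> W \<Longrightarrow> Q \<inter> {x. ev (fq' x) (a ` W) (a u)} = q' u"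
    and "\<And>u. u \<in> W \<Longrightarrow> R \<inter> {x. ev (fr x) (a ` W) (a u)} = r u"
    and "w \<in> W"
  shows "R \<inter> {k. ev (inst4 L (\<xi> k) fp fq fq' fr) (a ` W) (a w)} = transp W p q q' r w"
  unfolding transp_def using ev_inst4[OF vars_\<xi> assms] by auto

text \<open>\<open>\<beta>\<close> holds at the same valuations as \<open>\<gamma>\<close>; as it
  has no r-variables, their r-part may then be erased.\<close>

lemma sol_\<gamma>_imp_\<beta>:
  assumes "finite W" "sol_\<gamma> W p q r" "\<And>w. w \<in> W \<Longrightarrow> p w \<subseteq> P" "\<And>w. w \<in> W \<Longrightarrow> q w \<subseteq> Q"
  shows "sol_\<beta> W p q"
proof -
  let ?X = "PVar 0 ` P \<union> QVar 0 ` Q"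
  have "ev \<beta> ((\<lambda>u. pqr_vars (p u) (q u) (r u)) ` W) (pqr_vars (p w) (q w) (r w))" if "w \<in> W" for w
    using entailsD[OF \<gamma>_entails assms(1,2)] that unfolding valid_def by blast
  then have "ev \<beta> ((\<lambda>u. pqr_vars (p u) (q u) (r u) \<inter> ?X) ` W) (pqr_vars (p w) (q w) (r w) \<inter> ?X)"
    if "w \<in> W" for w
    using ev_restrict[OF vars_\<beta>, of "(\<lambda>u. pqr_vars (p u) (q u) (r u)) ` W"] that
    by (simp add: image_image)
  moreover have "pqr_vars (p w) (q w) (r w) \<inter> ?X = pqr_vars (p w) (q w) {}" if "w \<in> W" for w
    using assms(3,4)[OF that] by (auto simp: pqr_vars_def)
  ultimately show ?thesis
    by (simp add: valid_def cong: image_cong)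
qed

text \<open>A single valuation that carries the three copies of q at once, on which the cocycle
  condition can be read.\<close>

definition joint :: "'x set \<Rightarrow> 'x set \<Rightarrow> 'x set \<Rightarrow> 'x set \<Rightarrow> 'x set \<Rightarrow> 'x pqr_var set" where
  "joint p q1 q2 q3 r = PVar 0 ` p \<union> QVar 1 ` q1 \<union> QVar 2 ` q2 \<union> QVar 3 ` q3 \<union> RVar 0 ` r"

lemma ev_joint [simp]:
  "ev (pv L 0 x) S (joint p q1 q2 q3 r) \<longleftrightarrow> x \<in> p"
  "ev (qv L 1 x) S (joint p q1 q2 q3 r) \<longleftrightarrow> x \<in> q1"
  "ev (qv L (Suc 0) x) S (joint p q1 q2 q3 r) \<longleftrightarrow> x \<in> q1"
  "ev (qv L 2 x) S (joint p q1 q2 q3 r) \<longleftrightarrow> x \<in> q2"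
  "ev (qv L 3 x) S (joint p q1 q2 q3 r) \<longleftrightarrow> x \<in> q3"
  "ev (rv L 0 x) S (joint p q1 q2 q3 r) \<longleftrightarrow> x \<in> r"
  by (auto simp: joint_def pv_def qv_def rv_def ev_atom)

lemma transp_cocycle:
  assumes fin: "finite W"
    and sub: "\<And>w. w \<in> W \<Longrightarrow> p w \<subseteq> P" "\<And>w. w \<in> W \<Longrightarrow> q1 w \<subseteq> Q" "\<And>w. w \<in> W \<Longrightarrow> q2 w \<subseteq> Q"
      "\<And>w. w \<in> W \<Longrightarrow> q3 w \<subseteq> Q" "\<And>w. w \<in> W \<Longrightarrow> r w \<subseteq> R"
    and sol: "sol_\<gamma> W p q1 r" "sol_\<beta> W p q2" "sol_\<beta> W p q3"
    and w: "w \<in> W"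
  shows "transp W p q1 q3 r w = transp W p q2 q3 (transp W p q1 q2 r) w"
proof -
  define a where "a w = joint (p w) (q1 w) (q2 w) (q3 w) (r w)" for w
  note [simp] = Int_absorb1
  have *: "P \<inter> {x. ev (pv L 0 x) (a ` W) (a u)} = p u"
    "Q \<inter> {x. ev (qv L 1 x) (a ` W) (a u)} = q1 u"
    "Q \<inter> {x. ev (qv L 2 x) (a ` W) (a u)} = q2 u"
    "Q \<inter> {x. ev (qv L 3 x) (a ` W) (a u)} = q3 u"
    "R \<inter> {x. ev (rv L 0 x) (a ` W) (a u)} = r u" if "u \<in> W" for u
    using sub[OF that] by (auto simp: a_def)
  let ?t = "\<lambda>s. inst4 L (\<xi> s) (pv L 0) (qv L 1) (qv L 2) (rv L 0)"
  have t12: "R \<inter> {k. ev (?t k) (a ` W) (a u)} = transp W p q1 q2 r u" if "u \<in> W" for u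
    by (rule transp_inst4) (use * that in auto)
  have t13: "R \<inter> {k. ev (inst4 L (\<xi> k) (pv L 0) (qv L 1) (qv L 3) (rv L 0)) (a ` W) (a w)} =
      transp W p q1 q3 r w"
    by (rule transp_inst4) (use * w in auto)
  \<comment> \<open>The inner transport \<open>t12\<close> enters as the r-tuple of the outer
    one.\<close>
  have t23: "R \<inter> {k. ev (inst4 L (\<xi> k) (pv L 0) (qv L 2) (qv L 3) ?t) (a ` W) (a w)} =
      transp W p q2 q3 (transp W p q1 q2 r) w"
    by (rule transp_inst4) (use * w t12 in auto)
  let ?pre = "cnj L (cnj L (inst3 L \<gamma> (pv L 0) (qv L 1) (rv L 0)) (inst2 L \<beta> (pv L 0) (qv L 2)))
               (inst2 L \<beta> (pv L 0) (qv L 3))"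
  have "valid ?pre W a"
    using sol valid_inst3[OF vars_\<gamma> *(1,2,5)] valid_inst2[OF vars_\<beta> *(1,3)]
      valid_inst2[OF vars_\<beta> *(1,4)]
    by (simp add: valid_cnj)
  then have "\<forall>k\<in>R. valid (bicond L (inst4 L (\<xi> k) (pv L 0) (qv L 1) (qv L 3) (rv L 0))
      (inst4 L (\<xi> k) (pv L 0) (qv L 2) (qv L 3) ?t)) W a"
    using ltt fin entailsD unfolding local_transition_terms_def by blast
  then have "R \<inter> {k. ev (inst4 L (\<xi> k) (pv L 0) (qv L 1) (qv L 3) (rv L 0)) (a ` W) (a w)} =
     R \<inter> {k. ev (inst4 L (\<xi> k) (pv L 0) (qv L 2) (qv L 3) ?t) (a ` W) (a w)}"
    using w by (auto simp: valid_def ev_bicond)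
  then show ?thesis
    using t13 t23 by simp
qed

lemma transp_id:
  assumes fin: "finite W"
    and sub: "\<And>w. w \<in> W \<Longrightarrow> p w \<subseteq> P" "\<And>w. w \<in> W \<Longrightarrow> q w \<subseteq> Q" "\<And>w. w \<in> W \<Longrightarrow> r w \<subseteq> R"
    and sol: "sol_\<gamma> W p q r"
    and w: "w \<in> W"
  shows "transp W p q q r w = r w"
proof -
  define a where "a w = pqr_vars (p w) (q w) (r w)" for w
  have *: "P \<inter> {x. ev (pv L 0 x) (a ` W) (a u)} = p u"
    "Q \<inter> {x. ev (qv L 0 x) (a ` W) (a u)} = q u"
    "R \<inter> {x. ev (rv L 0 x) (a ` W) (a u)} = r u" if "u \<in> W" for u
    using sub[OF that] by (auto simp: a_def pqr_vars_def pv_def qv_def rv_def ev_atom)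
  have t: "R \<inter> {k. ev (inst4 L (\<xi> k) (pv L 0) (qv L 0) (qv L 0) (rv L 0)) (a ` W) (a w)} =
      transp W p q q r w"
    by (rule transp_inst4) (use * w in auto)
  have "valid (inst3 L \<gamma> (pv L 0) (qv L 0) (rv L 0)) W a"
    using sol valid_inst3[OF vars_\<gamma> *] by simp
  then have "\<forall>k\<in>R. valid (bicond L (rv L 0 k)
      (inst4 L (\<xi> k) (pv L 0) (qv L 0) (qv L 0) (rv L 0))) W a"
    using ltt fin entailsD unfolding local_transition_terms_def by blast
  then have "R \<inter> {k. ev (inst4 L (\<xi> k) (pv L 0) (qv L 0) (qv L 0) (rv L 0)) (a ` W) (a w)} =
     R \<inter> {k. ev (rv L 0 k) (a ` W) (a w)}"
    using w by (auto simp: valid_def ev_bicond)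
  then show ?thesis
    using t *(3)[OF w] by simp
qed

text \<open>\<open>U\<close> is itself a cluster: its points are pairs of a p-valuation and a
  q-valuation, and the projections are its tuples. \<open>\<Pi>\<close> is the set of p-valuations
  that occur.\<close>

definition solves :: "'x set set \<Rightarrow> ('x set \<times> 'x set) set \<Rightarrow> bool" where
  "solves \<Pi> U \<longleftrightarrow> finite U \<and> fst ` U = \<Pi> \<and> snd ` U \<subseteq> Pow Q \<and> sol_\<beta> U fst snd"

text \<open>A choice of one solution of \<open>\<beta>(p,q)\<close> that depends on \<open>p\<close> alone.  It lives on
  a larger cluster, since in general no solution is definable from \<open>p\<close>.\<close>

definition chosen :: "'x set set \<Rightarrow> ('x set \<times> 'x set) set" where
  "chosen \<Pi> = (SOME U. solves \<Pi> U)"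

text \<open>The fibre product of \<open>W\<close> and the chosen cluster over the p-valuations. When
  the choice succeeds both projections are surjective, so solutions on either side pull back to
  solutions on the cover.\<close>

definition cover :: "'w set \<Rightarrow> ('w \<Rightarrow> 'x set) \<Rightarrow> ('w \<times> 'x set) set" where
  "cover W p = {(w, u). w \<in> W \<and> (p w, u) \<in> chosen (p ` W)}"

text \<open>On the cover the second projection is the canonical solution; \<open>r\<close> is pulled
  back to the cover and transported to it.\<close>

definition coords where
  "coords W p q r w u = transp (cover W p) (p \<circ> fst) (q \<circ> fst) snd (r \<circ> fst) (w, u)"

text \<open>The model itself provides a candidate: the pairs \<open>(p w, q w)\<close>, which
  satisfy \<open>\<beta>\<close> by bisimulation invariance.\<close>

lemma chosen_solves:
  assumes "finite W" "sol_\<gamma> W p q r" "\<And>w. w \<in> W \<Longrightarrow> p w \<subseteq> P" "\<And>w. w \<in> W \<Longrightarrow> q w \<subseteq> Q"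
  shows "solves (p ` W) (chosen (p ` W))"
proof -
  have "sol_\<beta> W p q"
    by (rule sol_\<gamma>_imp_\<beta>[OF assms(1,2)]) (use assms in auto)
  then have "sol_\<beta> ((\<lambda>w. (p w, q w)) ` W) fst snd"
    by (simp add: valid_image comp_def)
  then have "solves (p ` W) ((\<lambda>w. (p w, q w)) ` W)"
    using assms by (auto simp: solves_def image_image)
  then show ?thesis
    unfolding chosen_def by (rule someI)
qed

text \<open>The choice depends on the image of \<open>p\<close> alone, and covers are compatible
  with maps of points. So coordinates see only the valuations, not the identity of the
  points.\<close>

lemma coords_image:
  "coords (h ` W) p q r (h w) u = coords W (p \<circ> h) (q \<circ> h) (r \<circ> h) w u"
proof -
  have "cover (h ` W) p = (\<lambda>(w, u). (h w, u)) ` cover W (p \<circ> h)"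
    by (auto simp: cover_def image_image image_iff)
  then show ?thesis
    unfolding coords_def
    using transp_image[of "\<lambda>(w, u). (h w, u)" "cover W (p \<circ> h)" "p \<circ> fst" "q \<circ> fst" snd "r \<circ> fst" "(w, u)"]
    by (simp add: comp_def case_prod_unfold)
qed

lemma cover_subset:
  assumes "solves (p ` W) (chosen (p ` W))" "m \<in> cover W p"
  shows "fst m \<in> W" "snd m \<subseteq> Q"
proof -
  have "(p (fst m), snd m) \<in> chosen (p ` W)" and "fst m \<in> W"
    using assms(2) by (auto simp: cover_def)
  moreover have "snd ` chosen (p ` W) \<subseteq> Pow Q"
    using assms(1) unfolding solves_def by blast
  ultimately show "fst m \<in> W" "snd m \<subseteq> Q"
    by (simp, metis PowD image_subset_iff snd_conv)
qed

text \<open>Both sides are compared with the common transport to the chosen solution.\<close>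

lemma transp_eq_iff_coords:
  assumes fin: "finite W"
    and sub: "\<And>w. w \<in> W \<Longrightarrow> p w \<subseteq> P" "\<And>w. w \<in> W \<Longrightarrow> q1 w \<subseteq> Q" "\<And>w. w \<in> W \<Longrightarrow> r1 w \<subseteq> R"
      "\<And>w. w \<in> W \<Longrightarrow> q2 w \<subseteq> Q" "\<And>w. w \<in> W \<Longrightarrow> r2 w \<subseteq> R"
    and sol: "sol_\<gamma> W p q1 r1" "sol_\<gamma> W p q2 r2"
  shows "(\<forall>w\<in>W. transp W p q1 q2 r1 w = r2 w) \<longleftrightarrow>
    (\<forall>w u. (w, u) \<in> cover W p \<longrightarrow> coords W p q1 r1 w u = coords W p q2 r2 w u)"
proof -
  let ?M = "cover W p"
  have U: "solves (p ` W) (chosen (p ` W))"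
    by (rule chosen_solves[OF fin sol(1)]) (use sub in auto)
  have finM: "finite ?M"
  proof (rule finite_subset)
    show "?M \<subseteq> W \<times> snd ` chosen (p ` W)" by (force simp: cover_def)
    show "finite (W \<times> snd ` chosen (p ` W))" using fin U by (simp add: solves_def)
  qed
  \<comment> \<open>Every p-valuation occurring on \<open>W\<close> has a chosen partner, so no
    fibre of the cover is empty.\<close>
  have surj: "fst ` ?M = W"
    using U by (force simp: cover_def solves_def image_iff)
  have subM: "(p \<circ> fst) m \<subseteq> P" "(q1 \<circ> fst) m \<subseteq> Q" "(r1 \<circ> fst) m \<subseteq> R"
     "(q2 \<circ> fst) m \<subseteq> Q" "(r2 \<circ> fst) m \<subseteq> R" "snd m \<subseteq> Q" if "m \<in> ?M" for m
    using sub cover_subset[OF U that] by simp_all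
  have sol1: "sol_\<gamma> ?M (p \<circ> fst) (q1 \<circ> fst) (r1 \<circ> fst)"
    using sol(1) surj valid_image[of \<gamma> fst ?M] by (simp add: comp_def)
  have sol2: "sol_\<gamma> ?M (p \<circ> fst) (q2 \<circ> fst) (r2 \<circ> fst)"
    using sol(2) surj valid_image[of \<gamma> fst ?M] by (simp add: comp_def)
  have sol\<beta>: "sol_\<beta> ?M (p \<circ> fst) (q2 \<circ> fst)"
    by (rule sol_\<gamma>_imp_\<beta>[OF finM sol2]) (use subM in simp_all)
  \<comment> \<open>The cover realises all of the chosen cluster and nothing else, so the second
    projection solves \<open>\<beta>\<close> on it.\<close>
  have "(\<lambda>m. (p (fst m), snd m)) ` ?M = chosen (p ` W)"
  proof
    show "chosen (p ` W) \<subseteq> (\<lambda>m. (p (fst m), snd m)) ` ?M"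
    proof
      fix z assume z: "z \<in> chosen (p ` W)"
      then have "fst z \<in> p ` W" using U unfolding solves_def by blast
      then obtain w where "w \<in> W" "p w = fst z" by auto
      then show "z \<in> (\<lambda>m. (p (fst m), snd m)) ` ?M"
        using z by (intro image_eqI[of _ _ "(w, snd z)"]) (simp_all add: cover_def)
    qed
  qed (auto simp: cover_def)
  then have sol0: "sol_\<beta> ?M (p \<circ> fst) snd"
    using U valid_image[of \<beta> "\<lambda>m. (p (fst m), snd m)" ?M] by (simp add: solves_def comp_def)
  let ?tr = "transp ?M (p \<circ> fst)"
  \<comment> \<open>Between two solutions pulled back from \<open>W\<close>, transport on the cover
    is the pullback of transport on \<open>W\<close>.\<close>
  have lift: "?tr (q1 \<circ> fst) (q2 \<circ> fst) (r1 \<circ> fst) m = transp W p q1 q2 r1 (fst m)" for m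
    using transp_image[of fst ?M p q1 q2 r1 m] surj by simp
  show ?thesis
  proof
    assume eq: "\<forall>w\<in>W. transp W p q1 q2 r1 w = r2 w"
    have "coords W p q1 r1 w u = coords W p q2 r2 w u" if m: "(w, u) \<in> ?M" for w u
    proof -
      \<comment> \<open>By the cocycle condition, the way from the first solution to the chosen one
        may pass through \<open>q2 \<circ> fst\<close>.\<close>
      have "?tr (q1 \<circ> fst) snd (r1 \<circ> fst) (w, u) =
          ?tr (q2 \<circ> fst) snd (?tr (q1 \<circ> fst) (q2 \<circ> fst) (r1 \<circ> fst)) (w, u)"
        by (rule transp_cocycle[OF finM _ _ _ _ _ sol1 sol\<beta> sol0 m]) (use subM in simp_all)
      also have "\<dots> = ?tr (q2 \<circ> fst) snd (r2 \<circ> fst) (w, u)"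
      proof -
        have *: "?tr (q1 \<circ> fst) (q2 \<circ> fst) (r1 \<circ> fst) m = (r2 \<circ> fst) m" if "m \<in> ?M" for m
          using eq that unfolding lift by (auto simp: cover_def)
        show ?thesis
          by (rule transp_cong, rule refl, rule refl, rule refl, erule *, rule m)
      qed
      finally show ?thesis by (simp add: coords_def)
    qed
    then show "\<forall>w u. (w, u) \<in> ?M \<longrightarrow> coords W p q1 r1 w u = coords W p q2 r2 w u"
      by blast
  next
    assume eq: "\<forall>w u. (w, u) \<in> ?M \<longrightarrow> coords W p q1 r1 w u = coords W p q2 r2 w u"
    show "\<forall>w\<in>W. transp W p q1 q2 r1 w = r2 w"
    proof
      fix w assume "w \<in> W"
      then obtain u where m: "(w, u) \<in> ?M" using surj by force
      have "transp W p q1 q2 r1 w = ?tr (q1 \<circ> fst) (q2 \<circ> fst) (r1 \<circ> fst) (w, u)"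
        by (simp add: lift)
      \<comment> \<open>Now the detour goes through the chosen solution, where equal coordinates
        allow \<open>r1\<close> over \<open>q1\<close> to be exchanged for \<open>r2\<close> over
        \<open>q2\<close>.\<close>
      also have "\<dots> = ?tr snd (q2 \<circ> fst) (?tr (q1 \<circ> fst) snd (r1 \<circ> fst)) (w, u)"
        by (rule transp_cocycle[OF finM _ _ _ _ _ sol1 sol0 sol\<beta> m]) (use subM in simp_all)
      also have "\<dots> = ?tr snd (q2 \<circ> fst) (?tr (q2 \<circ> fst) snd (r2 \<circ> fst)) (w, u)"
      proof -
        have *: "?tr (q1 \<circ> fst) snd (r1 \<circ> fst) m = ?tr (q2 \<circ> fst) snd (r2 \<circ> fst) m" if "m \<in> ?M" for m
          using eq that by (cases m) (auto simp: coords_def)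
        show ?thesis
          by (rule transp_cong, rule refl, rule refl, rule refl, erule *, rule m)
      qed
      \<comment> \<open>The way from \<open>q2\<close> to the chosen solution and back collapses to
        the transport from \<open>q2\<close> to itself, which fixes \<open>r2\<close>.\<close>
      also have "\<dots> = ?tr (q2 \<circ> fst) (q2 \<circ> fst) (r2 \<circ> fst) (w, u)"
        by (rule transp_cocycle[OF finM _ _ _ _ _ sol2 sol0 sol\<beta> m, symmetric])
          (use subM in simp_all)
      also have "\<dots> = r2 w"
        by (subst transp_id[OF finM _ _ _ sol2 m]) (use subM in simp_all)
      finally show "transp W p q1 q2 r1 w = r2 w" .
    qed
  qed
qed

text \<open>The fibre over \<open>w\<close> may have several points, so all pairs of
  \<open>u\<close> and its coordinate are collected. Packing each with \<open>p w\<close> into one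
  valuation makes \<open>p\<close> recoverable and lets valuations index the separating
  formulas.\<close>

definition classes where
  "classes W p q r w = {pqr_vars (p w) u (coords W p q r w u) | u. (w, u) \<in> cover W p}"

text \<open>Hence \<open>classes\<close> is a property of the pointed model, to which
  \<open>definable\<close> applies.\<close>

lemma classes_image: "classes (h ` W) p q r (h w) = classes W (p \<circ> h) (q \<circ> h) (r \<circ> h) w"
  if "w \<in> W"
  using that by (auto simp: classes_def coords_image cover_def image_image)

text \<open>Bounds the indices of the separating formulas: no other \<open>z\<close> can occur as a
  member.\<close>

lemma classes_subset:
  assumes "finite W" "sol_\<gamma> W p q r" "\<And>w. w \<in> W \<Longrightarrow> p w \<subseteq> P" "\<And>w. w \<in> W \<Longrightarrow> q w \<subseteq> Q"
    and "w \<in> W"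
  shows "classes W p q r w \<subseteq> Pow (pqr_vars P Q R)"
proof -
  have "coords W p q r w u \<subseteq> R" for u
    unfolding coords_def by (rule transp_subset)
  moreover have "solves (p ` W) (chosen (p ` W))"
    by (rule chosen_solves[OF assms(1,2)]) (use assms in auto)
  then have "u \<subseteq> Q" if "(w, u) \<in> cover W p" for u
    using cover_subset(2) that by force
  ultimately have "pqr_vars (p w) u (coords W p q r w u) \<subseteq> pqr_vars P Q R"
    if "(w, u) \<in> cover W p" for u
    using assms(3,5) that by (intro pqr_vars_mono) auto
  then show ?thesis
    by (auto simp only: classes_def)
qed

text \<open>Equal classes force equal p-valuations because the fibres are nonempty. Then the covers
  coincide, and comparing classes amounts to comparing coordinates at each \<open>u\<close>.\<close>

lemma transp_eq_iff_classes:
  assumes fin: "finite W"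
    and sub: "\<And>w. w \<in> W \<Longrightarrow> p1 w \<subseteq> P" "\<And>w. w \<in> W \<Longrightarrow> q1 w \<subseteq> Q" "\<And>w. w \<in> W \<Longrightarrow> r1 w \<subseteq> R"
      "\<And>w. w \<in> W \<Longrightarrow> p2 w \<subseteq> P" "\<And>w. w \<in> W \<Longrightarrow> q2 w \<subseteq> Q" "\<And>w. w \<in> W \<Longrightarrow> r2 w \<subseteq> R"
    and sol: "sol_\<gamma> W p1 q1 r1" "sol_\<gamma> W p2 q2 r2"
  shows "(\<forall>w\<in>W. p1 w = p2 w \<and> transp W p1 q1 q2 r1 w = r2 w) \<longleftrightarrow>
    (\<forall>w\<in>W. classes W p1 q1 r1 w = classes W p2 q2 r2 w)"
proof -
  have main: "(\<forall>w\<in>W. transp W p1 q1 q2 r1 w = r2 w) \<longleftrightarrow>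
    (\<forall>w\<in>W. classes W p1 q1 r1 w = classes W p2 q2 r2 w)" if eq: "\<forall>w\<in>W. p1 w = p2 w"
  proof -
    have im: "p2 ` W = p1 ` W" using eq by simp
    have cov: "cover W p2 = cover W p1" using eq unfolding cover_def im by auto
    have sol': "sol_\<gamma> W p1 q2 r2"
      using sol(2) eq by (simp add: valid_def cong: image_cong)
    have *: "(\<forall>w\<in>W. transp W p1 q1 q2 r1 w = r2 w) \<longleftrightarrow>
        (\<forall>w u. (w, u) \<in> cover W p1 \<longrightarrow> coords W p1 q1 r1 w u = coords W p1 q2 r2 w u)"
      by (rule transp_eq_iff_coords[OF fin _ _ _ _ _ sol(1) sol']) (use sub in auto)
    have "coords W p2 q2 r2 w u = coords W p1 q2 r2 w u" if "(w, u) \<in> cover W p1" for w u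
    proof -
      have *: "p2 (fst m) = p1 (fst m)" if "m \<in> cover W p1" for m
        using eq that by (auto simp: cover_def)
      show ?thesis
        unfolding coords_def cov by (rule transp_cong) (use * that in simp_all)
    qed
    then have "classes W p2 q2 r2 w =
        {pqr_vars (p1 w) u (coords W p1 q2 r2 w u) | u. (w, u) \<in> cover W p1}" if "w \<in> W" for w
      using eq that unfolding classes_def cov by (metis (no_types, lifting))
    \<comment> \<open>Recording \<open>u\<close> next to its coordinate makes the set determine the
      coordinate function.\<close>
    moreover have inj: "({pqr_vars p u (c u) | u. u \<in> C} = {pqr_vars p u (c' u) | u. u \<in> C}) \<longleftrightarrow>
        (\<forall>u\<in>C. c u = c' u)" for p C and c c' :: "'x set \<Rightarrow> 'x set"
      by (rule iffI) (blast dest: pqr_vars_eq_iff[THEN iffD1], metis)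
    have
      "(classes W p1 q1 r1 w = {pqr_vars (p1 w) u (coords W p1 q2 r2 w u) | u. (w, u) \<in> cover W p1})
       \<longleftrightarrow> (\<forall>u. (w, u) \<in> cover W p1 \<longrightarrow> coords W p1 q1 r1 w u = coords W p1 q2 r2 w u)" for w
      unfolding classes_def using inj[of _ _ "{u. (w, u) \<in> cover W p1}"] by simp
    ultimately have "(classes W p1 q1 r1 w = classes W p2 q2 r2 w) \<longleftrightarrow>
        (\<forall>u. (w, u) \<in> cover W p1 \<longrightarrow> coords W p1 q1 r1 w u = coords W p1 q2 r2 w u)" if "w \<in> W" for w
      using that by simp
    then have "(\<forall>w\<in>W. classes W p1 q1 r1 w = classes W p2 q2 r2 w) \<longleftrightarrow>
        (\<forall>w\<in>W. \<forall>u. (w, u) \<in> cover W p1 \<longrightarrow> coords W p1 q1 r1 w u = coords W p1 q2 r2 w u)"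
      by (intro ball_cong refl)
    moreover have "w \<in> W" if "(w, u) \<in> cover W p1" for w u
      using that by (simp add: cover_def)
    ultimately show ?thesis
      unfolding * by metis
  qed
  moreover have "p1 w = p2 w" if "\<forall>w\<in>W. classes W p1 q1 r1 w = classes W p2 q2 r2 w" "w \<in> W" for w
  proof -
    have "solves (p1 ` W) (chosen (p1 ` W))"
      by (rule chosen_solves[OF fin sol(1)]) (use sub in auto)
    then obtain u where "(w, u) \<in> cover W p1"
      using \<open>w \<in> W\<close> by (force simp: cover_def solves_def image_iff)
    then have "pqr_vars (p1 w) u (coords W p1 q1 r1 w u) \<in> classes W p1 q1 r1 w"
      unfolding classes_def by blast
    then have "pqr_vars (p1 w) u (coords W p1 q1 r1 w u) \<in> classes W p2 q2 r2 w"
      using that by simp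
    then show ?thesis
      by (auto simp: classes_def pqr_vars_eq_iff)
  qed
  ultimately show ?thesis by blast
qed

text \<open>The separating formula \<open>\<psi> z\<close> says that \<open>z\<close> is among the
  classes of the current point. The two copies agree on all of them throughout a cluster exactly if
  their classes agree at every point.\<close>

lemma separates: "separates_variables L P Q R \<gamma> \<xi>"
proof -
  let ?X = "pqr_vars P Q R"
  \<comment> \<open>The points are the valuations themselves here, with \<open>p_part\<close>,
    \<open>q_part\<close> and \<open>r_part\<close> as the tuples.\<close>
  have "\<forall>z. \<exists>a. vars L a \<subseteq> ?X \<and> (\<forall>S s. finite S \<longrightarrow> s \<in> S \<longrightarrow>
      (ev a S s \<longleftrightarrow> z \<in> classes ((\<lambda>t. t \<inter> ?X) ` S) p_part q_part r_part (s \<inter> ?X)))"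
    using definable[OF tup, of "\<lambda>S s. _ \<in> classes S p_part q_part r_part s"] by (intro allI) 
  then obtain \<psi> where vars_\<psi>: "vars L (\<psi> z) \<subseteq> ?X"
    and ev_\<psi>: "finite S \<Longrightarrow> s \<in> S \<Longrightarrow>
      ev (\<psi> z) S s \<longleftrightarrow> z \<in> classes ((\<lambda>t. t \<inter> ?X) ` S) p_part q_part r_part (s \<inter> ?X)" for z S s
    by metis
  define \<Psi> where "\<Psi> = \<psi> ` Pow ?X"
  define \<rho> where "\<rho> = local_coequivalence L P R \<gamma> \<xi>"
  define \<sigma> where "\<sigma> = cnj L
                   (cnj L (inst3 L \<gamma> (pv L 1) (qv L 1) (rv L 1))
                           (inst3 L \<gamma> (pv L 2) (qv L 2) (rv L 2)))
                   (bigcnj L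
                     ((\<lambda>\<psi>. bicond L (inst3 L \<psi> (pv L 1) (qv L 1) (rv L 1))
                                 (inst3 L \<psi> (pv L 2) (qv L 2) (rv L 2))) ` \<Psi>))"
  have "valid \<rho> S id \<longleftrightarrow> valid \<sigma> S id" if fin: "finite S" for S
  proof -
    define p where "p i s = P \<inter> {x. PVar i x \<in> s}" for i s
    define q where "q i s = Q \<inter> {x. QVar i x \<in> s}" for i s
    define r where "r i s = R \<inter> {x. RVar i x \<in> s}" for i s
    have sub: "p i s \<subseteq> P" "q i s \<subseteq> Q" "r i s \<subseteq> R" for i s
      by (auto simp: p_def q_def r_def)
    have *: "P \<inter> {x. ev (pv L i x) (id ` S) (id u)} = p i u"
      "Q \<inter> {x. ev (qv L i x) (id ` S) (id u)} = q i u"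
      "R \<inter> {x. ev (rv L i x) (id ` S) (id u)} = r i u" for i u
      by (auto simp: p_def q_def r_def pv_def qv_def rv_def ev_atom)
    have val\<gamma>: "valid (inst3 L \<gamma> (pv L i) (qv L i) (rv L i)) S id \<longleftrightarrow> sol_\<gamma> S (p i) (q i) (r i)" for i
      by (rule valid_inst3[OF vars_\<gamma>]) (use * in auto)
    have \<rho>: "valid \<rho> S id \<longleftrightarrow> sol_\<gamma> S (p 1) (q 1) (r 1) \<and> sol_\<gamma> S (p 2) (q 2) (r 2) \<and>
      (\<forall>s\<in>S. p 1 s = p 2 s \<and> transp S (p 1) (q 1) (q 2) (r 1) s = r 2 s)"
    proof -
      let ?t = "\<lambda>k. inst4 L (\<xi> k) (pv L 1) (qv L 1) (qv L 2) (rv L 1)"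
      have t: "R \<inter> {k. ev (?t k) (id ` S) (id s)} = transp S (p 1) (q 1) (q 2) (r 1) s"
        if "s \<in> S" for s
        by (rule transp_inst4) (use * that in auto)
      have 1: "valid (bigcnj L ((\<lambda>p. bicond L (pv L 1 p) (pv L 2 p)) ` P)) S id \<longleftrightarrow>
        (\<forall>s\<in>S. p 1 s = p 2 s)"
        unfolding *[symmetric] valid_def ev_bigcnj[OF family_tuple(1)[OF tup]]
        by (auto simp: ev_bicond)
      have 2: "valid (bigcnj L ((\<lambda>k. bicond L (?t k) (rv L 2 k)) ` R)) S id \<longleftrightarrow>
        (\<forall>s\<in>S. transp S (p 1) (q 1) (q 2) (r 1) s = r 2 s)"
        using t[symmetric] unfolding *[symmetric] valid_def ev_bigcnj[OF family_tuple(2)[OF tup]]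
        by (auto simp: ev_bicond)
      show ?thesis
        unfolding \<rho>_def local_coequivalence_def valid_cnj val\<gamma> 1 2 by blast
    qed
    have \<sigma>: "valid \<sigma> S id \<longleftrightarrow> sol_\<gamma> S (p 1) (q 1) (r 1) \<and> sol_\<gamma> S (p 2) (q 2) (r 2) \<and>
      (\<forall>s\<in>S. \<forall>z\<in>Pow ?X. z \<in> classes S (p 1) (q 1) (r 1) s \<longleftrightarrow> z \<in> classes S (p 2) (q 2) (r 2) s)"
    proof -
      have "ev (inst3 L (\<psi> z) (pv L i) (qv L i) (rv L i)) (id ` S) (id s) \<longleftrightarrow>
          z \<in> classes S (p i) (q i) (r i) s" if s: "s \<in> S" for z i s
      proof -
        let ?h = "\<lambda>s. pqr_vars (p i s) (q i s) (r i s)"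
        have hX: "?h s \<inter> ?X = ?h s" for s
          using pqr_vars_mono[OF sub] by blast
        have "ev (inst3 L (\<psi> z) (pv L i) (qv L i) (rv L i)) (id ` S) (id s) \<longleftrightarrow>
            ev (\<psi> z) (?h ` S) (?h s)"
          by (rule ev_inst3[OF vars_\<psi>]) (use * s in auto)
        also have "\<dots> \<longleftrightarrow> z \<in> classes (?h ` S) p_part q_part r_part (?h s)"
          using fin s by (subst ev_\<psi>) (simp_all add: image_image hX)
        \<comment> \<open>\<open>?h\<close> labels the points of \<open>S\<close> by the i-th copy;
          invariance under maps of points leads back from the labels to \<open>S\<close>.\<close>
        also have "\<dots> \<longleftrightarrow> z \<in> classes S (p i) (q i) (r i) s"
          using s by (subst classes_image) (simp_all add: comp_def)
        finally show ?thesis .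
      qed
      then have "valid (bigcnj L ((\<lambda>\<psi>. bicond L (inst3 L \<psi> (pv L 1) (qv L 1) (rv L 1))
                (inst3 L \<psi> (pv L 2) (qv L 2) (rv L 2))) ` \<Psi>)) S id \<longleftrightarrow>
       (\<forall>s\<in>S. \<forall>z\<in>Pow ?X. z \<in> classes S (p 1) (q 1) (r 1) s \<longleftrightarrow> z \<in> classes S (p 2) (q 2) (r 2) s)"
        unfolding valid_def \<Psi>_def image_image ev_bigcnj[OF family_Pow[OF tup]]
        by (simp add: ev_bicond)
      then show ?thesis
        unfolding \<sigma>_def valid_cnj val\<gamma> by blast
    qed
    have "(\<forall>s\<in>S. p 1 s = p 2 s \<and> transp S (p 1) (q 1) (q 2) (r 1) s = r 2 s) \<longleftrightarrow>
      (\<forall>s\<in>S. \<forall>z\<in>Pow ?X. z \<in> classes S (p 1) (q 1) (r 1) s \<longleftrightarrow> z \<in> classes S (p 2) (q 2) (r 2) s)"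
      if sol: "sol_\<gamma> S (p 1) (q 1) (r 1)" "sol_\<gamma> S (p 2) (q 2) (r 2)"
    proof -
      have "classes S (p i) (q i) (r i) s \<subseteq> Pow ?X" if "s \<in> S" "i \<in> {1, 2}" for i s
        by (rule classes_subset) (use that sol fin sub in auto)
      then have "(\<forall>z\<in>Pow ?X. z \<in> classes S (p 1) (q 1) (r 1) s \<longleftrightarrow> z \<in> classes S (p 2) (q 2) (r 2) s)
        \<longleftrightarrow> classes S (p 1) (q 1) (r 1) s = classes S (p 2) (q 2) (r 2) s" if "s \<in> S" for s
        using that by blast
      then show ?thesis
        using transp_eq_iff_classes[OF fin sub sub sol] by simp
    qed
    then show ?thesis
      unfolding \<rho> \<sigma> by blast
  qed
  then have "entails L \<rho> \<sigma>" "entails L \<sigma> \<rho>"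
    by (auto intro: entails_validI)
  moreover have "family L \<Psi>"
    unfolding \<Psi>_def by (rule family_Pow[OF tup])
  ultimately show ?thesis
    unfolding separates_variables_def Let_def \<rho>_def \<sigma>_def
    using vars_\<psi> by (intro exI[of _ \<Psi>]) (auto simp: \<Psi>_def pqr_vars_def)
qed

end

section \<open>The separation property for logics with finite cluster semantics\<close>

context cluster_semantics
begin

lemma LCoSP: "LCoSP L"
  unfolding LCoSP_def
proof (intro allI impI)
  fix P Q R \<alpha> \<beta> \<gamma> \<xi>
  assume "tuple L P" "tuple L Q" "tuple L R"
    and "\<beta> \<in> Ext L (PVar 0 ` P \<union> QVar 0 ` Q) \<alpha>"
    and "\<gamma> \<in> Ext L (PVar 0 ` P \<union> QVar 0 ` Q \<union> RVar 0 ` R) \<beta>"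
    and "local_transition_terms L P Q R \<beta> \<gamma> \<xi>"
  then interpret transition L box ev P Q R \<beta> \<gamma> \<xi>
    by unfold_locales (auto simp: Ext_def pqr_vars_def)
  show "separates_variables L P Q R \<gamma> \<xi>"
    by (rule separates)
qed

end

section \<open>Soundness and completeness of S5\<close>

primrec fm_ev :: "'v fm \<Rightarrow> 'v set set \<Rightarrow> 'v set \<Rightarrow> bool" where
  "fm_ev (Var v) S s \<longleftrightarrow> v \<in> s"
| "fm_ev Bot S s \<longleftrightarrow> False"
| "fm_ev (Neg \<phi>) S s \<longleftrightarrow> \<not> fm_ev \<phi> S s"
| "fm_ev (And \<phi> \<psi>) S s \<longleftrightarrow> fm_ev \<phi> S s \<and> fm_ev \<psi> S s"
| "fm_ev (Box \<phi>) S s \<longleftrightarrow> (\<forall>t\<in>S. fm_ev \<phi> S t)"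

lemma prop_eval_Imp [simp]: "prop_eval h (Imp \<phi> \<psi>) \<longleftrightarrow> (prop_eval h \<phi> \<longrightarrow> prop_eval h \<psi>)"
  by (simp add: Imp_def)

lemma fm_ev_Imp [simp]: "fm_ev (Imp \<phi> \<psi>) S s \<longleftrightarrow> (fm_ev \<phi> S s \<longrightarrow> fm_ev \<psi> S s)"
  by (simp add: Imp_def)

text \<open>Truth at a point is a propositional evaluation with the boxed formulas as atoms, hence
  tautologies are valid.\<close>

lemma prop_eval_fm_ev: "prop_eval (\<lambda>\<psi>. fm_ev \<psi> S s) \<phi> = fm_ev \<phi> S s"
  by (induction \<phi>) auto

lemma S5_sound:
  assumes "S5_derives \<alpha> \<phi>" "\<forall>s\<in>S. fm_ev \<alpha> S s"
  shows "\<forall>s\<in>S. fm_ev \<phi> S s"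
  using assms(1)
proof induction
  case (axiom \<phi>)
  then show ?case
  proof cases
    case taut
    then show ?thesis using prop_eval_fm_ev by blast
  qed (auto simp: Dia_def)
qed (use assms(2) in auto)

section \<open>Derived rules and introspection\<close>

lemma derives_taut: "(\<And>h. prop_eval h \<phi>) \<Longrightarrow> S5_derives \<alpha> \<phi>"
  by (rule S5_derives.axiom[OF S5_axiom.taut])

lemma derives_taut1:
  assumes "S5_derives \<alpha> \<phi>" "\<And>h. prop_eval h \<phi> \<Longrightarrow> prop_eval h \<psi>"
  shows "S5_derives \<alpha> \<psi>"
  by (rule S5_derives.MP[OF derives_taut assms(1)]) (use assms(2) in simp)

lemma derives_taut2:
  assumes "S5_derives \<alpha> \<phi>" "S5_derives \<alpha> \<phi>'"
    "\<And>h. prop_eval h \<phi> \<Longrightarrow> prop_eval h \<phi>' \<Longrightarrow> prop_eval h \<psi>"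
  shows "S5_derives \<alpha> \<psi>"
  by (rule S5_derives.MP[OF derives_taut1[OF assms(1)] assms(2)]) (use assms(3) in simp)

lemma derives_Box_mono: "S5_derives \<alpha> (Imp \<phi> \<psi>) \<Longrightarrow> S5_derives \<alpha> (Imp (Box \<phi>) (Box \<psi>))"
  by (rule S5_derives.MP[OF S5_derives.axiom[OF S5_axiom.K] S5_derives.Nec])

text \<open>This is axiom \<open>Five\<close> at \<open>Neg \<phi>\<close>, once the double negation
  produced by \<open>Dia\<close> is removed under the boxes.\<close>

lemma derives_neg_introspection: "S5_derives \<alpha> (Imp (Neg (Box \<phi>)) (Box (Neg (Box \<phi>))))"
proof -
  let ?N = "Neg (Neg \<phi>)"
  have 1: "S5_derives \<alpha> (Imp (Box ?N) (Box \<phi>))" and "S5_derives \<alpha> (Imp (Box \<phi>) (Box ?N))"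
    by (rule derives_Box_mono, rule derives_taut, simp)+
  then have 2: "S5_derives \<alpha> (Imp (Box (Neg (Box ?N))) (Box (Neg (Box \<phi>))))"
    by (intro derives_Box_mono) (erule derives_taut1, auto)
  have 3: "S5_derives \<alpha> (Imp (Neg (Box ?N)) (Box (Neg (Box ?N))))"
    using S5_derives.axiom[OF S5_axiom.Five, of \<alpha> "Neg \<phi>"] by (simp add: Dia_def)
  have "S5_derives \<alpha> (Imp (Neg (Box \<phi>)) (Box (Neg (Box ?N))))"
    by (rule derives_taut2[OF 1 3]) auto
  then show ?thesis
    by (rule derives_taut2[OF _ 2]) auto
qed

text \<open>The chain is: \<open>Box \<phi>\<close> implies \<open>Dia (Box \<phi>)\<close> by
  \<open>T\<close>, which \<open>Five\<close> boxes; under the box, negative introspection reduces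
  \<open>Dia (Box \<phi>)\<close> to \<open>Box \<phi>\<close>.\<close>

lemma derives_introspection: "S5_derives \<alpha> (Imp (Box \<phi>) (Box (Box \<phi>)))"
proof -
  let ?N = "Neg (Box (Neg (Box \<phi>)))"
  have 1: "S5_derives \<alpha> (Imp (Box ?N) (Box (Box \<phi>)))"
    by (rule derives_Box_mono, rule derives_taut1[OF derives_neg_introspection[of _ \<phi>]]) auto
  have 2: "S5_derives \<alpha> (Imp ?N (Box ?N))"
    using S5_derives.axiom[OF S5_axiom.Five, of \<alpha> "Box \<phi>"] by (simp add: Dia_def)
  have "S5_derives \<alpha> (Imp ?N (Box (Box \<phi>)))"
    by (rule derives_taut2[OF 1 2]) auto
  then show ?thesis
    by (rule derives_taut2[OF _ S5_derives.axiom[OF S5_axiom.T[of "Neg (Box \<phi>)"]]]) auto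
qed

text \<open>Closure under necessitation is not demanded: such a theory describes a single point,
  while the global premise enters through everything derivable from it.\<close>

definition closed_theory :: "'v fm \<Rightarrow> 'v fm set \<Rightarrow> bool" where
  "closed_theory \<alpha> T \<longleftrightarrow>
     (\<forall>\<phi>. S5_derives \<alpha> \<phi> \<longrightarrow> \<phi> \<in> T) \<and> (\<forall>\<phi> \<psi>. Imp \<phi> \<psi> \<in> T \<longrightarrow> \<phi> \<in> T \<longrightarrow> \<psi> \<in> T)"

definition complete_theory :: "'v fm \<Rightarrow> 'v fm set \<Rightarrow> bool" where
  "complete_theory \<alpha> T \<longleftrightarrow> closed_theory \<alpha> T \<and> (\<forall>\<phi>. Neg \<phi> \<in> T \<longleftrightarrow> \<phi> \<notin> T)"

lemma closed_derives: "closed_theory \<alpha> T \<Longrightarrow> S5_derives \<alpha> \<phi> \<Longrightarrow> \<phi> \<in> T"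
  by (simp add: closed_theory_def)

lemma closed_MP: "closed_theory \<alpha> T \<Longrightarrow> Imp \<phi> \<psi> \<in> T \<Longrightarrow> \<phi> \<in> T \<Longrightarrow> \<psi> \<in> T"
  unfolding closed_theory_def by blast

lemma closed_derives_MP: "closed_theory \<alpha> T \<Longrightarrow> S5_derives \<alpha> (Imp \<phi> \<psi>) \<Longrightarrow> \<phi> \<in> T \<Longrightarrow> \<psi> \<in> T"
  by (rule closed_MP[OF _ closed_derives])

lemma closed_taut1:
  assumes "closed_theory \<alpha> T" "\<phi> \<in> T" "\<And>h. prop_eval h \<phi> \<Longrightarrow> prop_eval h \<psi>"
  shows "\<psi> \<in> T"
  by (rule closed_derives_MP[OF assms(1) derives_taut assms(2)]) (use assms(3) in simp)

lemma closed_taut2: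
  assumes "closed_theory \<alpha> T" "\<phi> \<in> T" "\<phi>' \<in> T"
    "\<And>h. prop_eval h \<phi> \<Longrightarrow> prop_eval h \<phi>' \<Longrightarrow> prop_eval h \<psi>"
  shows "\<psi> \<in> T"
  by (rule closed_MP[OF assms(1) closed_taut1[OF assms(1,2)] assms(3)]) (use assms(4) in simp)

text \<open>A form of the deduction theorem: this set is the extension of \<open>T\<close> by
  \<open>\<chi>\<close>.\<close>

lemma closed_theory_conditional:
  assumes T: "closed_theory \<alpha> T"
  shows "closed_theory \<alpha> {\<eta>. Imp \<chi> \<eta> \<in> T}"
  unfolding closed_theory_def
proof (intro conjI allI impI; unfold mem_Collect_eq)
  fix \<phi> assume "S5_derives \<alpha> \<phi>"
  then have "\<phi> \<in> T" by (rule closed_derives[OF T])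
  then show "Imp \<chi> \<phi> \<in> T" by (rule closed_taut1[OF T]) simp
next
  fix \<phi> \<psi> assume "Imp \<chi> (Imp \<phi> \<psi>) \<in> T" "Imp \<chi> \<phi> \<in> T"
  then show "Imp \<chi> \<psi> \<in> T" by (rule closed_taut2[OF T]) simp
qed

text \<open>Lindenbaum's lemma: Zorn's lemma gives a theory maximal among those that omit
  \<open>\<phi>\<close>, and this maximality yields completeness.\<close>

lemma complete_extension:
  assumes T: "closed_theory \<alpha> T" and \<phi>: "\<phi> \<notin> T"
  shows "\<exists>M. complete_theory \<alpha> M \<and> T \<subseteq> M \<and> \<phi> \<notin> M"
proof -
  let ?A = "{M. T \<subseteq> M \<and> closed_theory \<alpha> M \<and> \<phi> \<notin> M}"
  have "\<exists>M\<in>?A. \<forall>X\<in>?A. M \<subseteq> X \<longrightarrow> X = M"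
  proof (rule subset_Zorn_nonempty)
    show "?A \<noteq> {}" using T \<phi> by blast
  next
    fix C assume C: "C \<noteq> {}" "subset.chain ?A C"
    then have CA: "M \<in> ?A" if "M \<in> C" for M
      using that by (auto simp: subset.chain_def)
    have "closed_theory \<alpha> (\<Union> C)"
      unfolding closed_theory_def
    proof (intro conjI allI impI)
      show "\<psi> \<in> \<Union> C" if "S5_derives \<alpha> \<psi>" for \<psi>
        using C(1) CA closed_derives[OF _ that] by blast
    next
      fix \<psi> \<eta> assume "Imp \<psi> \<eta> \<in> \<Union> C" "\<psi> \<in> \<Union> C"
      then obtain M M' where M: "M \<in> C" "Imp \<psi> \<eta> \<in> M" "M' \<in> C" "\<psi> \<in> M'" by blast
      then have "M \<subseteq> M' \<or> M' \<subseteq> M"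
        using C(2) by (auto simp: subset_chain_def)
      then obtain N where "N \<in> C" "Imp \<psi> \<eta> \<in> N" "\<psi> \<in> N"
        using M by blast
      then show "\<eta> \<in> \<Union> C"
        using CA closed_MP by blast
    qed
    then show "\<Union> C \<in> ?A" using C(1) CA by blast
  qed
  then obtain M where M: "T \<subseteq> M" "closed_theory \<alpha> M" "\<phi> \<notin> M"
    and "\<forall>X\<in>?A. M \<subseteq> X \<longrightarrow> X = M"
    by (elim bexE) (simp, metis)
  then have max: "X = M" if "T \<subseteq> X" "closed_theory \<alpha> X" "\<phi> \<notin> X" "M \<subseteq> X" for X
    using that by simp
  \<comment> \<open>Otherwise the extension of \<open>M\<close> by \<open>\<chi>\<close> still omits
    \<open>\<phi>\<close>, against maximality.\<close>
  have *: "Imp \<chi> \<phi> \<in> M" if "\<chi> \<notin> M" for \<chi>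
  proof (rule ccontr)
    let ?X = "{\<eta>. Imp \<chi> \<eta> \<in> M}"
    assume "Imp \<chi> \<phi> \<notin> M"
    moreover have "M \<subseteq> ?X"
      by (auto intro: closed_taut1[OF M(2)])
    ultimately have "?X = M"
      using M(1) by (intro max closed_theory_conditional[OF M(2)]) auto
    moreover have "\<chi> \<in> ?X"
      by (simp add: closed_derives[OF M(2) derives_taut])
    ultimately show False using that by simp
  qed
  have "Neg \<chi> \<in> M \<longleftrightarrow> \<chi> \<notin> M" for \<chi>
  proof
    assume "Neg \<chi> \<in> M"
    then show "\<chi> \<notin> M"
      using closed_taut2[OF M(2), of "Neg \<chi>" \<chi> \<phi>] M(3) by auto
  next
    assume "\<chi> \<notin> M"
    then have "Imp \<chi> \<phi> \<in> M" by (rule *)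
    \<comment> \<open>If \<open>Neg \<chi>\<close> were missing too, \<open>\<phi>\<close> would
      follow in \<open>M\<close> by cases.\<close>
    then show "Neg \<chi> \<in> M"
      using * closed_taut2[OF M(2), of "Imp \<chi> \<phi>" "Imp (Neg \<chi>) \<phi>" \<phi>] M(3) by auto
  qed
  then show ?thesis
    using M by (auto simp: complete_theory_def)
qed

lemma closed_theory_Box:
  assumes T: "closed_theory \<alpha> T"
  shows "closed_theory \<alpha> {\<phi>. Box \<phi> \<in> T}"
  unfolding closed_theory_def
proof (intro conjI allI impI; unfold mem_Collect_eq)
  fix \<phi> assume "S5_derives \<alpha> \<phi>"
  then show "Box \<phi> \<in> T" by (intro closed_derives[OF T] S5_derives.Nec)
next
  fix \<phi> \<psi> assume "Box (Imp \<phi> \<psi>) \<in> T" "Box \<phi> \<in> T"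
  then show "Box \<psi> \<in> T"
    using closed_MP[OF T] closed_derives[OF T S5_derives.axiom[OF S5_axiom.K]] by blast
qed

text \<open>The complete theories with the same boxed formulas as some \<open>T0\<close> omitting
  \<open>\<beta>\<close> form a canonical cluster that refutes \<open>\<beta>\<close>. Restricting
  valuations to the variables of the two formulas makes it finite without affecting their
  truth.\<close>

lemma S5_complete:
  assumes valid: "\<And>S. finite S \<Longrightarrow> \<forall>s\<in>S. fm_ev \<alpha> S s \<Longrightarrow> \<forall>s\<in>S. fm_ev \<beta> S s"
  shows "S5_derives \<alpha> \<beta>"
proof (rule ccontr)
  assume "\<not> S5_derives \<alpha> \<beta>"
  moreover have "closed_theory \<alpha> {\<phi>. S5_derives \<alpha> \<phi>}"
    by (auto simp: closed_theory_def intro: S5_derives.MP)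
  ultimately obtain T0 where T0: "complete_theory \<alpha> T0" "\<beta> \<notin> T0"
    using complete_extension by (metis mem_Collect_eq)
  define C where "C = {T. complete_theory \<alpha> T \<and> (\<forall>\<phi>. Box \<phi> \<in> T \<longleftrightarrow> Box \<phi> \<in> T0)}"
  have closed: "closed_theory \<alpha> T" and Neg: "Neg \<phi> \<in> T \<longleftrightarrow> \<phi> \<notin> T" if "T \<in> C" for T \<phi>
    using that by (auto simp: C_def complete_theory_def)
  have T0C: "T0 \<in> C" using T0 by (simp add: C_def)
  have Box: "Box \<phi> \<in> T \<longleftrightarrow> (\<forall>U\<in>C. \<phi> \<in> U)" if T: "T \<in> C" for T \<phi>
  proof
    assume "Box \<phi> \<in> T"
    then have "Box \<phi> \<in> U" if "U \<in> C" for U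
      using T that by (simp add: C_def)
    then show "\<forall>U\<in>C. \<phi> \<in> U"
      using closed_derives_MP[OF closed S5_derives.axiom[OF S5_axiom.T]] by blast
  next
    assume all: "\<forall>U\<in>C. \<phi> \<in> U"
    show "Box \<phi> \<in> T"
    proof (rule ccontr)
      assume "Box \<phi> \<notin> T"
      then have "\<phi> \<notin> {\<phi>. Box \<phi> \<in> T0}" using T by (simp add: C_def)
      from complete_extension[OF closed_theory_Box[OF closed[OF T0C]] this]
      obtain U where U: "complete_theory \<alpha> U" "{\<phi>. Box \<phi> \<in> T0} \<subseteq> U" "\<phi> \<notin> U" by blast
      \<comment> \<open>Both introspection principles pass boxed formulas and their negations from
        \<open>T0\<close> to \<open>U\<close>, so \<open>U\<close> lies in the same cluster.\<close>
      have "Box \<psi> \<in> U \<longleftrightarrow> Box \<psi> \<in> T0" for \<psi>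
      proof (cases "Box \<psi> \<in> T0")
        case True
        then have "Box (Box \<psi>) \<in> T0"
          by (rule closed_derives_MP[OF closed[OF T0C] derives_introspection])
        then show ?thesis using True U(2) by blast
      next
        case False
        then have "Neg (Box \<psi>) \<in> T0" using Neg[OF T0C] by simp
        then have "Box (Neg (Box \<psi>)) \<in> T0"
          by (rule closed_derives_MP[OF closed[OF T0C] derives_neg_introspection])
        then have "Neg (Box \<psi>) \<in> U" using U(2) by blast
        then show ?thesis using False U(1) by (simp add: complete_theory_def)
      qed
      then have "U \<in> C" using U(1) by (simp add: C_def)
      then show False using all U(3) by blast
    qed
  qed
  have Bot: "Bot \<notin> T" if "T \<in> C" for T
    using closed_derives[OF closed[OF that] derives_taut[of "Neg Bot"]] Neg[OF that] by simp
  have And: "And \<phi> \<psi> \<in> T \<longleftrightarrow> \<phi> \<in> T \<and> \<psi> \<in> T" if T: "T \<in> C" for T \<phi> \<psi>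
  proof
    assume "And \<phi> \<psi> \<in> T"
    then show "\<phi> \<in> T \<and> \<psi> \<in> T"
      using closed_taut1[OF closed[OF T], of "And \<phi> \<psi>"] by simp
  next
    assume "\<phi> \<in> T \<and> \<psi> \<in> T"
    then show "And \<phi> \<psi> \<in> T"
      using closed_taut2[OF closed[OF T], of \<phi> \<psi>] by simp
  qed
  define X where "X = fm_vars \<alpha> \<union> fm_vars \<beta>"
  have "finite (fm_vars \<phi>)" for \<phi> :: "'a fm" by (induction \<phi>) auto
  then have X: "finite X" by (simp add: X_def)
  \<comment> \<open>Identifying theories that agree on \<open>X\<close> leaves finitely many
    valuations.\<close>
  define val where "val T = {v \<in> X. Var v \<in> T}" for T
  have truth: "fm_ev \<phi> (val ` C) (val T) \<longleftrightarrow> \<phi> \<in> T" if "T \<in> C" "fm_vars \<phi> \<subseteq> X" for T \<phi>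
    using that by (induction \<phi> arbitrary: T) (auto simp: val_def Bot Neg And Box)
  have "finite (val ` C)"
    by (rule finite_subset[of _ "Pow X"]) (use X in \<open>auto simp: val_def\<close>)
  moreover have "\<forall>s\<in>val ` C. fm_ev \<alpha> (val ` C) s"
    using truth closed_derives[OF closed S5_derives.premise] by (auto simp: X_def)
  ultimately have "fm_ev \<beta> (val ` C) (val T0)"
    using valid T0C by blast
  then show False
    using truth[OF T0C, of \<beta>] T0(2) by (simp add: X_def)
qed

lemma S5_derives_iff:
  "S5_derives \<alpha> \<beta> \<longleftrightarrow>
    (\<forall>S. finite S \<longrightarrow> (\<forall>s\<in>S. fm_ev \<alpha> S s) \<longrightarrow> (\<forall>s\<in>S. fm_ev \<beta> S s))"
proof
  assume "S5_derives \<alpha> \<beta>"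
  then show "\<forall>S. finite S \<longrightarrow> (\<forall>s\<in>S. fm_ev \<alpha> S s) \<longrightarrow> (\<forall>s\<in>S. fm_ev \<beta> S s)"
    by (intro allI impI) (rule S5_sound)
next
  assume "\<forall>S. finite S \<longrightarrow> (\<forall>s\<in>S. fm_ev \<alpha> S s) \<longrightarrow> (\<forall>s\<in>S. fm_ev \<beta> S s)"
  then show "S5_derives \<alpha> \<beta>"
    by (intro S5_complete) simp
qed

section \<open>S5 as an instance of the cluster semantics\<close>

lemma fm_bigconj_eq: "finite A \<Longrightarrow> \<exists>\<phi>s. fm_bigconj A = foldr And \<phi>s (Neg Bot) \<and> set \<phi>s = A"
  unfolding fm_bigconj_def using someI_ex[OF finite_list] by blast

lemma fm_ev_foldr: "fm_ev (foldr And \<phi>s (Neg Bot)) S s \<longleftrightarrow> (\<forall>\<phi>\<in>set \<phi>s. fm_ev \<phi> S s)"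
  by (induction \<phi>s) auto

lemma fm_vars_foldr: "fm_vars (foldr And \<phi>s (Neg Bot)) = (\<Union>\<phi>\<in>set \<phi>s. fm_vars \<phi>)"
  by (induction \<phi>s) auto

lemma fm_ev_subst: "fm_ev (fm_subst \<sigma> \<phi>) S s \<longleftrightarrow>
    fm_ev \<phi> ((\<lambda>t. {v. fm_ev (\<sigma> v) S t}) ` S) {v. fm_ev (\<sigma> v) S s}"
  by (induction \<phi> arbitrary: s) auto

lemma fm_ev_restrict:
  "fm_vars \<phi> \<subseteq> X \<Longrightarrow> fm_ev \<phi> ((\<lambda>t. t \<inter> X) ` S) (s \<inter> X) \<longleftrightarrow> fm_ev \<phi> S s"
  by (induction \<phi> arbitrary: s) auto

lemma S5_cluster_semantics: "cluster_semantics S5 Box fm_ev"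
proof
  fix P Q R :: "'a set" and f :: "_ \<Rightarrow> 'a pqr_var fm"
  assume "tuple S5 P" "tuple S5 Q" "tuple S5 R"
  then have "finite (pqr_vars P Q R)"
    by (simp add: S5_def pqr_vars_def)
  then have "finite (Pow (Pow (pqr_vars P Q R)) \<times> Pow (pqr_vars P Q R))"
    by simp
  then have "finite (pointed_models (pqr_vars P Q R))"
    by (rule finite_subset[rotated]) (auto simp: pointed_models_def)
  then show "family S5 (f ` pointed_models (pqr_vars P Q R))"
    by (simp add: S5_def)
next
  fix A :: "'a pqr_var fm set" assume "family S5 A"
  then have "finite A" by (simp add: S5_def)
  then obtain \<phi>s where *: "fm_bigconj A = foldr And \<phi>s (Neg Bot)" "A = set \<phi>s"
    using fm_bigconj_eq by blast
  show "fm_ev (bigcnj S5 A) S s \<longleftrightarrow> (\<forall>a\<in>A. fm_ev a S s)" for S s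
    using * fm_ev_foldr by (simp add: S5_def)
  show "vars S5 (bigcnj S5 A) = (\<Union>a\<in>A. vars S5 a)"
    using * fm_vars_foldr by (simp add: S5_def)
qed (simp_all add: S5_def fm_ev_subst fm_ev_restrict S5_derives_iff finite_subset)

section \<open>Locally finite frames\<close>

primrec ifm_ev :: "('v, 'k) ifm \<Rightarrow> 'v set set \<Rightarrow> 'v set \<Rightarrow> bool" where
  "ifm_ev (IVar v) S s \<longleftrightarrow> v \<in> s"
| "ifm_ev (INeg \<phi>) S s \<longleftrightarrow> \<not> ifm_ev \<phi> S s"
| "ifm_ev (IConj I f) S s \<longleftrightarrow> (\<forall>i\<in>I. ifm_ev (f i) S s)"
| "ifm_ev (IBox \<phi>) S s \<longleftrightarrow> (\<forall>t\<in>S. ifm_ev \<phi> S t)"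

lemma ifm_ev_subst: "ifm_ev (ifm_subst \<sigma> \<phi>) S s \<longleftrightarrow>
    ifm_ev \<phi> ((\<lambda>t. {v. ifm_ev (\<sigma> v) S t}) ` S) {v. ifm_ev (\<sigma> v) S s}"
  by (induction \<phi> arbitrary: s) auto

lemma ifm_ev_restrict:
  "ifm_vars \<phi> \<subseteq> X \<Longrightarrow> ifm_ev \<phi> ((\<lambda>t. t \<inter> X) ` S) (s \<inter> X) \<longleftrightarrow> ifm_ev \<phi> S s"
  by (induction \<phi> arbitrary: s) (auto, blast+)

text \<open>\<open>IBox\<close> looks only at the class of a point, and there only at the valuations
  that occur.\<close>

lemma sat_eq_ifm_ev:
  assumes E: "equiv W E" and u: "u \<in> E `` {w}"
  shows "sat E V u \<phi> \<longleftrightarrow> ifm_ev \<phi> ((\<lambda>u. {v. u \<in> V v}) ` (E `` {w})) {v. u \<in> V v}"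
  using u
proof (induction \<phi> arbitrary: u)
  case (IBox \<phi>)
  have "E `` {u} = E `` {w}"
    using equiv_class_eq[OF E, of w u] IBox.prems by simp
  then have "sat E V u (IBox \<phi>) \<longleftrightarrow> (\<forall>u'\<in>E `` {w}. sat E V u' \<phi>)"
    by auto
  then show ?case using IBox.IH by simp
qed simp_all

text \<open>Truth is decided class by class, and each class is a finite cluster. Conversely, an
  infinite type has room for clusters of every finite size.\<close>

lemma ifm_entails_iff:
  fixes \<alpha> \<beta> :: "('v, 'k) ifm"
  assumes inf: "infinite (UNIV :: 'w set)"
  shows "ifm_entails TYPE('w) \<alpha> \<beta> \<longleftrightarrow>
    (\<forall>S. finite S \<longrightarrow> (\<forall>s\<in>S. ifm_ev \<alpha> S s) \<longrightarrow> (\<forall>s\<in>S. ifm_ev \<beta> S s))"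
proof (intro iffI allI impI)
  fix S :: "'v set set"
  assume ent: "ifm_entails TYPE('w) \<alpha> \<beta>" and fin: "finite S" and \<alpha>: "\<forall>s\<in>S. ifm_ev \<alpha> S s"
  obtain W :: "'w set" where "finite W" "card W = card S"
    using infinite_arbitrarily_large[OF inf] by blast
  then obtain g where g: "bij_betw g W S"
    using fin finite_same_card_bij by metis
  let ?E = "W \<times> W" and ?V = "\<lambda>v. {w \<in> W. v \<in> g w}"
  have E: "equiv W ?E"
    by (auto simp: equiv_def refl_on_def sym_on_def trans_on_def)
  have fr: "locally_finite_S5_frame W ?E"
    using E \<open>finite W\<close> by (auto simp: locally_finite_S5_frame_def quotient_def Image_def)
  have sat: "sat ?E ?V w \<phi> \<longleftrightarrow> ifm_ev \<phi> S (g w)" if w: "w \<in> W" for w and \<phi> :: "('v, 'k) ifm"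
  proof -
    have "?E `` {w} = W" using w by auto
    moreover have "(\<lambda>u. {v. u \<in> ?V v}) ` W = S"
      using g by (auto simp: bij_betw_def)
    ultimately show ?thesis
      using sat_eq_ifm_ev[OF E, of w w ?V \<phi>] w by simp
  qed
  have "\<forall>w\<in>W. sat ?E ?V w \<alpha>"
    using \<alpha> g by (auto simp: sat bij_betw_def)
  moreover have "\<forall>v. ?V v \<subseteq> W" by blast
  ultimately have "\<forall>w\<in>W. sat ?E ?V w \<beta>"
    using ent[unfolded ifm_entails_def, rule_format, OF fr] by simp
  then show "\<forall>s\<in>S. ifm_ev \<beta> S s"
    using g by (auto simp: sat bij_betw_def)
next
  assume *: "\<forall>S. finite S \<longrightarrow> (\<forall>s\<in>S. ifm_ev \<alpha> S s) \<longrightarrow> (\<forall>s\<in>S. ifm_ev \<beta> S s)"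
  show "ifm_entails TYPE('w) \<alpha> \<beta>"
    unfolding ifm_entails_def
  proof (intro allI impI ballI)
    fix W :: "'w set" and E V w
    assume fr: "locally_finite_S5_frame W E" and \<alpha>: "\<forall>w\<in>W. sat E V w \<alpha>" and w: "w \<in> W"
    have E: "equiv W E" and fin: "finite (E `` {w})"
      using fr w unfolding locally_finite_S5_frame_def quotient_def by auto
    have sub: "E `` {w} \<subseteq> W" and wE: "w \<in> E `` {w}"
      using E w by (auto simp: equiv_def refl_on_def)
    let ?S = "(\<lambda>u. {v. u \<in> V v}) ` (E `` {w})"
    have "\<forall>s\<in>?S. ifm_ev \<alpha> ?S s"
      using \<alpha> sub sat_eq_ifm_ev[OF E, of _ w V \<alpha>] by blast
    then have "\<forall>s\<in>?S. ifm_ev \<beta> ?S s"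
      using * fin by blast
    then show "sat E V w \<beta>"
      using sat_eq_ifm_ev[OF E wE, of V \<beta>] wE by blast
  qed
qed

section \<open>Cardinal bounds for infinitary conjunctions\<close>

lemma inj_pair_infinite:
  assumes "infinite (UNIV :: 'k set)"
  shows "\<exists>f :: 'k \<times> 'k \<Rightarrow> 'k. inj f"
  using card_of_Times_same_infinite[OF assms]
  unfolding card_of_ordIso[symmetric] UNIV_Times_UNIV bij_betw_def by blast

text \<open>Iterated pairing is injective on lists of a given length; storing the length separates
  the rest.\<close>

lemma inj_list_infinite:
  assumes "infinite (UNIV :: 'k set)"
  shows "\<exists>f :: 'k list \<Rightarrow> 'k. inj f"
proof -
  obtain c :: "'k \<times> 'k \<Rightarrow> 'k" where c: "inj c"
    using inj_pair_infinite[OF assms] by blast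
  obtain n :: "nat \<Rightarrow> 'k" where n: "inj n"
    using assms infinite_countable_subset by blast
  define e where "e xs = foldr (\<lambda>x y. c (x, y)) xs undefined" for xs
  have e: "xs = ys" if "length xs = length ys" "e xs = e ys" for xs ys
    using that
    by (induction xs ys rule: list_induct2) (auto simp: e_def inj_eq[OF c])
  have "inj (\<lambda>xs. c (n (length xs), e xs))"
    by (rule injI) (auto simp: inj_eq[OF c] inj_eq[OF n] intro: e)
  then show ?thesis by blast
qed

lemma ifm_family_image:
  fixes g :: "'a \<Rightarrow> 'k" and f :: "'a \<Rightarrow> ('v, 'k) ifm"
  assumes "inj_on g A"
  shows "ifm_family (f ` A)"
  unfolding ifm_family_def
proof (intro exI)
  show "f ` A = (f \<circ> inv_into A g) ` (g ` A)"
    using assms by (auto simp: image_image)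
qed

lemma ifm_family_finite:
  assumes "infinite (UNIV :: 'k set)" "finite A"
  shows "ifm_family (A :: ('v, 'k) ifm set)"
proof -
  obtain B :: "'k set" where "finite B" "card B = card A"
    using infinite_arbitrarily_large[OF assms(1)] by blast
  then obtain g where "bij_betw g A B"
    using finite_same_card_bij[OF assms(2)] by metis
  then show ?thesis
    unfolding ifm_family_iff bij_betw_def by blast
qed

text \<open>A valuation is three sets of names, hence a triple of codes under \<open>h\<close>. A
  pointed model becomes a finite list: the code of the point followed by the codes of the valuations
  in \<open>S\<close>.\<close>

lemma inj_pointed_models:
  assumes inf: "infinite (UNIV :: 'k set)" and h: "inj (h :: 'x set \<Rightarrow> 'k)"
  shows "\<exists>g :: _ \<Rightarrow> 'k. inj_on g (pointed_models (pqr_vars P Q (R :: 'x set)))"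
proof -
  let ?X = "pqr_vars P Q R"
  obtain l :: "'k list \<Rightarrow> 'k" where l: "inj l"
    using inj_list_infinite[OF inf] by blast
  define k where "k s = l [h (p_part s), h (q_part s), h (r_part s)]" for s
  have k: "inj_on k (Pow ?X)"
  proof (rule inj_onI)
    fix s t assume st: "s \<in> Pow ?X" "t \<in> Pow ?X" and "k s = k t"
    then have "p_part s = p_part t" "q_part s = q_part t" "r_part s = r_part t"
      using inj_eq[OF l] inj_eq[OF h] by (simp_all add: k_def)
    then have "pqr_vars (p_part s) (q_part s) (r_part s) = pqr_vars (p_part t) (q_part t) (r_part t)"
      by simp
    then show "s = t" using st by (simp add: pqr_vars_parts)
  qed
  \<comment> \<open>The order of the enumeration is arbitrary, since only its underlying set has to
    be recovered.\<close>
  define xs where "xs S = (SOME xs. set xs = S)" for S :: "'x pqr_var set set"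
  have xs: "set (xs S) = S" if "finite S" for S
    unfolding xs_def using someI_ex[OF finite_list[OF that]] .
  have "inj_on (\<lambda>(S, s). l (k s # map k (xs S))) (pointed_models ?X)"
  proof (rule inj_onI, clarify)
    fix S s S' s'
    assume m: "(S, s) \<in> pointed_models ?X" "(S', s') \<in> pointed_models ?X"
      and "l (k s # map k (xs S)) = l (k s' # map k (xs S'))"
    then have eq: "k s = k s'" "map k (xs S) = map k (xs S')"
      unfolding inj_eq[OF l] by simp_all
    have "finite S" "finite S'"
      using m by (auto simp: pointed_models_def)
    then have "k ` S = k ` S'"
      using arg_cong[OF eq(2), of set] by (simp add: xs)
    moreover have "S \<subseteq> Pow ?X" "S' \<subseteq> Pow ?X" "s \<in> Pow ?X" "s' \<in> Pow ?X"
      using m by (auto simp: pointed_models_def)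
    ultimately show "S = S' \<and> s = s'"
      using inj_on_image_eq_iff[OF k, of S S'] inj_onD[OF k eq(1)] by simp
  qed
  then show ?thesis by blast
qed

text \<open>\<open>'w\<close> must hold every finite cluster, \<open>'k\<close> must index finite
  conjunctions, and \<open>h\<close> bounds the conjunctions over pointed models.\<close>

lemma S5_inf_cluster_semantics:
  assumes w: "infinite (UNIV :: 'w set)" and k: "infinite (UNIV :: 'k set)"
    and h: "inj (h :: 'x set \<Rightarrow> 'k)"
  shows "cluster_semantics (S5_inf TYPE('w) :: ('x, ('x pqr_var, 'k) ifm) modal_logic) IBox ifm_ev"
    (is "cluster_semantics ?L _ _")
proof
  fix P Q R :: "'x set" and f :: "_ \<Rightarrow> ('x pqr_var, 'k) ifm"
  show "family ?L (f ` pointed_models (pqr_vars P Q R))"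
  proof -
    obtain g :: "_ \<Rightarrow> 'k" where "inj_on g (pointed_models (pqr_vars P Q R))"
      using inj_pointed_models[OF k h] by blast
    from ifm_family_image[OF this] show ?thesis
      by (simp add: S5_inf_def)
  qed
next
  fix A :: "('x pqr_var, 'k) ifm set" assume "family ?L A"
  then have "ifm_family A" by (simp add: S5_inf_def)
  then obtain I f where *: "ifm_bigconj A = IConj I f" "A = f ` I"
    using ifm_bigconj_eq by blast
  show "ifm_ev (bigcnj ?L A) S s \<longleftrightarrow> (\<forall>a\<in>A. ifm_ev a S s)" for S s
    using * by (simp add: S5_inf_def)
  show "vars ?L (bigcnj ?L A) = (\<Union>a\<in>A. vars ?L a)"
    using * by (simp add: S5_inf_def)
  show "family ?L B" if "B \<subseteq> A" for B
    using \<open>ifm_family A\<close> inj_on_subset[OF _ that] unfolding ifm_family_iff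
    by (simp add: S5_inf_def ifm_family_iff) blast
next
  fix a b :: "('x pqr_var, 'k) ifm" and S s
  \<comment> \<open>A binary conjunction is formed from the set \<open>{a, b}\<close>, a singleton
    if \<open>a = b\<close>; so it is evaluated through its set of conjuncts.\<close>
  obtain I f where *: "ifm_bigconj {a, b} = IConj I f" "{a, b} = f ` I"
    using ifm_bigconj_eq[OF ifm_family_finite[OF k, of "{a, b}"]] by blast
  have "ifm_ev (ifm_bigconj {a, b}) S s \<longleftrightarrow> (\<forall>c\<in>f ` I. ifm_ev c S s)"
    unfolding *(1) by simp
  then show "ifm_ev (cnj ?L a b) S s \<longleftrightarrow> ifm_ev a S s \<and> ifm_ev b S s"
    unfolding *(2)[symmetric] by (simp add: S5_inf_def)
qed (simp_all add: S5_inf_def ifm_ev_subst ifm_ev_restrict ifm_entails_iff[OF w] ifm_family_finite[OF k])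

theorem theorem5p19:
  shows "LCoSP (S5 :: ('a, 'a pqr_var fm) modal_logic) \<and>
    (infinite (UNIV :: 'w set) \<longrightarrow>
     infinite (UNIV :: 'k set) \<longrightarrow>
     (\<exists>h :: 'x set \<Rightarrow> 'k. inj h) \<longrightarrow>
     LCoSP (S5_inf TYPE('w) :: ('x, ('x pqr_var, 'k) ifm) modal_logic))"
  using cluster_semantics.LCoSP[OF S5_cluster_semantics]
    cluster_semantics.LCoSP[OF S5_inf_cluster_semantics] by blast

end
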